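(* Let $X$ be a Banach space which is polyhedral and satisfies the metric $\pi$-property. Assume that $Y$ is a dual Banach space. Then every tensor in $X\widehat{\otimes}_\pi Y$ can be approximated by tensors that attain their norms, that is, $\overline{\mathrm{NA}_\pi(X\widehat{\otimes}_\pi Y)}^{\|\cdot\|_\pi}=X\widehat{\otimes}_\pi Y$.
   Context: $S_X$ is the unit sphere of $X$. $X$ is polyhedral if the closed unit ball of every finite-dimensional subspace of $X$ is a polytope, that is, the convex hull of a finite set. $X$ has the metric $\pi$-property if, given $\varepsilon>0$ and $\{x_1,\dots,x_n\}\subseteq S_X$, there are a finite-dimensional $1$-complemented subspace $M\subseteq X$ (i.e. the range of a norm-one linear projection on $X$) and $x_i'\in M$ with $\|x_i-x_i'\|<\varepsilon$ for every $i=1,\dots,n$. "$Y$ is a dual space" means $Y=Z^*$ (isometrically) for some Banach space $Z$. $X\widehat{\otimes}_\pi Y$ is the projective tensor product, the completion of $X\otimes Y$ under $\|z\|_\pi=\inf\{\sum_{i=1}^n\|x_i\|\|y_i\|: z=\sum_{i=1}^n x_i\otimes y_i\}$. An element $z\in X\widehat{\otimes}_\pi Y$ attains its projective norm if there is a bounded sequence $(x_n,y_n)_{n=1}^\infty\subseteq X\times Y$ with $\sum_{n=1}^\infty\|x_n\|\|y_n\|<\infty$, $z=\sum_{n=1}^\infty x_n\otimes y_n$ and $\|z\|_\pi=\sum_{n=1}^\infty\|x_n\|\|y_n\|$; the set of all such $z$ is denoted $\mathrm{NA}_\pi(X\widehat{\otimes}_\pi Y)$. *)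

theory Defs
  imports "HOL-Analysis.Analysis"
begin

section \<open>Sublinear functionals and separation of points\<close>

definition sublinear :: "('a::real_vector \<Rightarrow> real) \<Rightarrow> bool" where
  "sublinear p \<longleftrightarrow> (\<forall>x y. p (x + y) \<le> p x + p y) \<and> (\<forall>t x. 0 \<le> t \<longrightarrow> p (t *\<^sub>R x) = t * p x)"

lemma sublinear_add: "sublinear p \<Longrightarrow> p (x + y) \<le> p x + p y"
  and sublinear_scale: "sublinear p \<Longrightarrow> 0 \<le> t \<Longrightarrow> p (t *\<^sub>R x) = t * p x"
  by (auto simp: sublinear_def)

lemma sublinear_zero: "sublinear p \<Longrightarrow> p 0 = 0"
  using sublinear_scale[of p 0 0] by simp

lemma sublinear_lower: "sublinear p \<Longrightarrow> - p (- x) \<le> p x"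
  using sublinear_add[of p x "- x"] sublinear_zero[of p] by simp

lemma sublinear_decrease:
  assumes p: "sublinear p"
  obtains q where "sublinear q" "q \<le> p" "q (- u) \<le> - p u"
proof -
  define q where "q x = (INF t\<in>{0::real..}. p (x + t *\<^sub>R u) - t * p u)" for x
  have lb: "- p (- x) \<le> p (x + t *\<^sub>R u) - t * p u" if "0 \<le> t" for t x
    using sublinear_add[OF p, of "x + t *\<^sub>R u" "- x"] sublinear_scale[OF p that, of u] by simp
  have bdd: "bdd_below ((\<lambda>t. p (x + t *\<^sub>R u) - t * p u) ` {0..})" for x
    using lb by (auto intro!: bdd_belowI)
  have upper: "q x \<le> p (x + t *\<^sub>R u) - t * p u" if "0 \<le> t" for x t
    unfolding q_def using that by (intro cINF_lower bdd) auto
  have greatest: "c \<le> q x" if "\<And>t. 0 \<le> t \<Longrightarrow> c \<le> p (x + t *\<^sub>R u) - t * p u" for c x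
    unfolding q_def using that by (intro cINF_greatest) auto
  have add: "q (x + y) \<le> q x + q y" for x y
  proof -
    have "q (x + y) - q y \<le> p (x + s *\<^sub>R u) - s * p u" if s: "0 \<le> s" for s
    proof -
      have "q (x + y) - (p (x + s *\<^sub>R u) - s * p u) \<le> p (y + t *\<^sub>R u) - t * p u" if t: "0 \<le> t" for t
      proof -
        have "q (x + y) \<le> p (x + y + (s + t) *\<^sub>R u) - (s + t) * p u"
          using s t by (intro upper) auto
        moreover have "x + y + (s + t) *\<^sub>R u = (x + s *\<^sub>R u) + (y + t *\<^sub>R u)"
          by (simp add: algebra_simps)
        ultimately show ?thesis
          using sublinear_add[OF p, of "x + s *\<^sub>R u" "y + t *\<^sub>R u"] by (simp add: algebra_simps)
      qed
      from greatest[OF this] show ?thesis by linarith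
    qed
    from greatest[OF this] show ?thesis by linarith
  qed
  have q0: "q 0 = 0"
  proof (rule antisym)
    show "q 0 \<le> 0" using upper[of 0 0] sublinear_zero[OF p] by simp
    show "0 \<le> q 0" by (rule greatest) (simp add: sublinear_scale[OF p])
  qed
  have scale_le: "c * q x \<le> q (c *\<^sub>R x)" if c: "0 < c" for c x
  proof (rule greatest)
    fix t :: real assume t: "0 \<le> t"
    have "c * q x \<le> c * (p (x + (t / c) *\<^sub>R u) - (t / c) * p u)"
      using c t by (intro mult_left_mono upper) auto
    also have "\<dots> = p (c *\<^sub>R (x + (t / c) *\<^sub>R u)) - t * p u"
      using c by (subst sublinear_scale[OF p]) (auto simp: algebra_simps)
    finally show "c * q x \<le> p (c *\<^sub>R x + t *\<^sub>R u) - t * p u"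
      using c by (simp add: scaleR_right_distrib)
  qed
  have scale: "q (c *\<^sub>R x) = c * q x" if c: "0 \<le> c" for c x
  proof (cases "c = 0")
    case False
    then have c: "0 < c" using c by simp
    have "inverse c * q (c *\<^sub>R x) \<le> q (inverse c *\<^sub>R c *\<^sub>R x)"
      using c by (intro scale_le) auto
    then have "q (c *\<^sub>R x) \<le> c * q x" using c by (simp add: field_simps)
    with scale_le[OF c, of x] show ?thesis by simp
  qed (simp add: q0)
  show ?thesis
  proof
    show "sublinear q" using add scale by (auto simp: sublinear_def)
    show "q \<le> p" using upper[of 0] by (auto simp: le_fun_def)
    show "q (- u) \<le> - p u" using upper[of 1 "- u"] sublinear_zero[OF p] by simp
  qed
qed

lemma sublinear_dominates_linear:
  assumes p: "sublinear p"
  obtains f where "linear f" "f \<le> p"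
proof -
  define A where "A = {q. sublinear q \<and> q \<le> p}"
  define R where "R = relation_of (\<lambda>q r. r \<le> q) A"
  have po: "partial_order_on A R"
    unfolding R_def
    by (auto simp: partial_order_on_def preorder_on_def refl_on_def trans_def antisym_def relation_of_def)
  have "\<exists>u\<in>A. \<forall>q\<in>C. u \<le> q" if C: "C \<in> Chains R" for C
  proof (cases "C = {}")
    case True
    then show ?thesis using p by (auto simp: A_def)
  next
    case False
    have CA: "sublinear q" "q \<le> p" if "q \<in> C" for q
      using C that by (auto simp: Chains_def R_def relation_of_def A_def)
    have chain: "q \<le> r \<or> r \<le> q" if "q \<in> C" "r \<in> C" for q r
      using C that by (auto simp: Chains_def R_def relation_of_def)
    define m where "m x = (INF q\<in>C. q x)" for x
    have "- p (- x) \<le> q x" if "q \<in> C" for q x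
      using sublinear_lower[OF CA(1)[OF that], of x] le_funD[OF CA(2)[OF that], of "- x"] by linarith
    then have bdd: "bdd_below ((\<lambda>q. q x) ` C)" for x by (auto intro!: bdd_belowI)
    have upper: "m x \<le> q x" if "q \<in> C" for q x
      unfolding m_def using that by (intro cINF_lower bdd)
    have greatest: "c \<le> m x" if "\<And>q. q \<in> C \<Longrightarrow> c \<le> q x" for c x
      unfolding m_def using that False by (intro cINF_greatest) auto
    have add: "m (x + y) \<le> m x + m y" for x y
    proof -
      have "m (x + y) - m y \<le> q x" if q: "q \<in> C" for q
      proof -
        have "m (x + y) - q x \<le> r y" if r: "r \<in> C" for r
        proof (cases "q \<le> r")
          case True
          then show ?thesis
            using upper[OF q, of "x + y"] sublinear_add[OF CA(1)[OF q], of x y] le_funD[OF True, of y]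
            by linarith
        next
          case False
          then have "r \<le> q" using chain q r by blast
          then show ?thesis
            using upper[OF r, of "x + y"] sublinear_add[OF CA(1)[OF r], of x y] le_funD[of r q x]
            by linarith
        qed
        then have "m (x + y) - q x \<le> m y" by (rule greatest)
        then show ?thesis by linarith
      qed
      then have "m (x + y) - m y \<le> m x" by (rule greatest)
      then show ?thesis by linarith
    qed
    have m0: "m 0 = 0"
      unfolding m_def using False CA(1) by (simp add: sublinear_zero cong: INF_cong_simp)
    have scale_le: "c * m x \<le> m (c *\<^sub>R x)" if "0 \<le> c" for c x
      using that by (intro greatest) (auto simp: sublinear_scale[OF CA(1)] intro!: mult_left_mono upper)
    have scale: "m (c *\<^sub>R x) = c * m x" if c: "0 \<le> c" for c x
    proof (cases "c = 0")
      case False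
      have "inverse c * m (c *\<^sub>R x) \<le> m (inverse c *\<^sub>R c *\<^sub>R x)"
        using c by (intro scale_le) auto
      then have "m (c *\<^sub>R x) \<le> c * m x" using c False by (simp add: field_simps)
      with scale_le[OF c, of x] show ?thesis by simp
    qed (simp add: m0)
    obtain q where "q \<in> C" using False by auto
    then have "m \<le> p" using upper CA(2) by (fastforce simp: le_fun_def intro: order_trans)
    then have "m \<in> A" using add scale by (auto simp: A_def sublinear_def)
    then show ?thesis using upper by (auto simp: le_fun_def)
  qed
  from predicate_Zorn[OF po[unfolded R_def] this[unfolded R_def]]
  obtain f where f: "f \<in> A" and min: "\<And>q. q \<in> A \<Longrightarrow> q \<le> f \<Longrightarrow> q = f" by blast
  have sub: "sublinear f" and le: "f \<le> p" using f by (auto simp: A_def)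
  have neg: "f (- x) = - f x" for x
  proof -
    obtain q where q: "sublinear q" "q \<le> f" "q (- x) \<le> - f x"
      using sublinear_decrease[OF sub] by blast
    with le have "q = f" by (intro min) (auto simp: A_def)
    then show ?thesis using q(3) sublinear_lower[OF sub, of "- x"] by simp
  qed
  have add: "f (x + y) = f x + f y" for x y
    using sublinear_add[OF sub, of x y] sublinear_add[OF sub, of "- x" "- y"] neg[of x] neg[of y]
      neg[of "x + y"] by (simp add: algebra_simps)
  have "f (c *\<^sub>R x) = c *\<^sub>R f x" for c x
  proof (cases "0 \<le> c")
    case True
    then show ?thesis by (simp add: sublinear_scale[OF sub])
  next
    case False
    then have "f (c *\<^sub>R x) = f (- ((- c) *\<^sub>R x))" by simp
    also have "\<dots> = c *\<^sub>R f x" using False by (subst neg, subst sublinear_scale[OF sub]) auto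
    finally show ?thesis .
  qed
  with add have "linear f" by (intro linearI)
  with le show ?thesis using that by blast
qed

lemma norming_functional:
  fixes u :: "'a::real_normed_vector"
  obtains f :: "'a \<Rightarrow> real" where "linear f" "\<And>x. \<bar>f x\<bar> \<le> norm x" "f u = norm u"
proof -
  have "sublinear (norm :: 'a \<Rightarrow> real)" by (auto simp: sublinear_def norm_triangle_ineq)
  then obtain q :: "'a \<Rightarrow> real" where q: "sublinear q" "q \<le> norm" "q (- u) \<le> - norm u"
    using sublinear_decrease by blast
  obtain f where f: "linear f" "f \<le> q" using sublinear_dominates_linear[OF q(1)] by blast
  have le: "f x \<le> norm x" for x
    using le_funD[OF f(2), of x] le_funD[OF q(2), of x] by linarith
  have neg: "f (- x) = - f x" for x using linear_neg[OF f(1)] .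
  show ?thesis
  proof
    show "linear f" by fact
    show "\<bar>f x\<bar> \<le> norm x" for x using le[of x] le[of "- x"] neg[of x] by (simp add: abs_le_iff)
    show "f u = norm u" using le[of u] le_funD[OF f(2), of "- u"] q(3) neg[of u] by linarith
  qed
qed

section \<open>The algebraic tensor product\<close>

text \<open>As in Ryan's book, the tensor product is built as a space of linear functionals on the space of
  bilinear forms: \<open>x \<otimes> y\<close> is evaluation at \<open>(x, y)\<close>. Finite sums are indexed by lists of pairs.
  A functional is extended by \<open>0\<close> to functions that are not bilinear.\<close>

definition eval_pairs :: "('a::real_vector \<times> 'b::real_vector) list \<Rightarrow> ('a \<Rightarrow> 'b \<Rightarrow> real) \<Rightarrow> real" where
  "eval_pairs ps = (\<lambda>B. if bilinear B then (\<Sum>(x, y)\<leftarrow>ps. B x y) else 0)"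

typedef (overloaded) ('a::real_vector, 'b::real_vector) tensor =
  "range (eval_pairs :: ('a \<times> 'b) list \<Rightarrow> ('a \<Rightarrow> 'b \<Rightarrow> real) \<Rightarrow> real)"
  by blast

setup_lifting type_definition_tensor

lift_definition tensor :: "'a::real_vector \<Rightarrow> 'b::real_vector \<Rightarrow> ('a, 'b) tensor" (infixl "\<otimes>" 70)
  is "\<lambda>x y. eval_pairs [(x, y)]" by blast

lemma eval_pairs_append: "eval_pairs (ps @ qs) = (\<lambda>B. eval_pairs ps B + eval_pairs qs B)"
  by (auto simp: eval_pairs_def)

lemma eval_pairs_scale: "eval_pairs (map (\<lambda>(x, y). (c *\<^sub>R x, y)) ps) = (\<lambda>B. c * eval_pairs ps B)"
proof
  fix B :: "'a \<Rightarrow> 'b \<Rightarrow> real"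
  show "eval_pairs (map (\<lambda>(x, y). (c *\<^sub>R x, y)) ps) B = c * eval_pairs ps B"
    by (induction ps) (auto simp: eval_pairs_def bilinear_lmul algebra_simps)
qed

instantiation tensor :: (real_vector, real_vector) real_vector
begin

lift_definition zero_tensor :: "('a, 'b) tensor" is "\<lambda>B. 0"
  by (rule range_eqI[of _ _ "[]"]) (auto simp: eval_pairs_def)

lift_definition plus_tensor :: "('a, 'b) tensor \<Rightarrow> ('a, 'b) tensor \<Rightarrow> ('a, 'b) tensor"
  is "\<lambda>f g B. f B + g B"
  by (auto simp: eval_pairs_append[symmetric])

lift_definition scaleR_tensor :: "real \<Rightarrow> ('a, 'b) tensor \<Rightarrow> ('a, 'b) tensor"
  is "\<lambda>c f B. c * f B"
  by (auto simp: eval_pairs_scale[symmetric])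

definition uminus_tensor :: "('a, 'b) tensor \<Rightarrow> ('a, 'b) tensor" where
  "uminus_tensor z = (-1) *\<^sub>R z"

definition minus_tensor :: "('a, 'b) tensor \<Rightarrow> ('a, 'b) tensor \<Rightarrow> ('a, 'b) tensor" where
  "minus_tensor z w = z + - w"

instance
proof
  fix x y z :: "('a, 'b) tensor" and a b :: real
  show "x + y + z = x + (y + z)" by transfer (simp add: add.assoc)
  show "x + y = y + x" by transfer (simp add: add.commute)
  show "0 + x = x" by transfer simp
  show "- x + x = 0" unfolding uminus_tensor_def by transfer simp
  show "x - y = x + - y" by (rule minus_tensor_def)
  show "a *\<^sub>R (x + y) = a *\<^sub>R x + a *\<^sub>R y" by transfer (simp add: algebra_simps)
  show "(a + b) *\<^sub>R x = a *\<^sub>R x + b *\<^sub>R x" by transfer (simp add: algebra_simps)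
  show "a *\<^sub>R b *\<^sub>R x = (a * b) *\<^sub>R x" by transfer (simp add: mult.assoc)
  show "1 *\<^sub>R x = x" by transfer simp
qed

end

lemma Rep_tensor_sum: "Rep_tensor (\<Sum>(x, y)\<leftarrow>ps. x \<otimes> y) = eval_pairs ps"
proof (induction ps)
  case (Cons p ps)
  then show ?case
    by (cases p) (auto simp: plus_tensor.rep_eq tensor.rep_eq eval_pairs_def fun_eq_iff)
qed (auto simp: zero_tensor.rep_eq eval_pairs_def)

lemma tensor_representation:
  obtains ps where "z = (\<Sum>(x, y)\<leftarrow>ps. x \<otimes> y)"
  by (metis Rep_tensor Rep_tensor_inject Rep_tensor_sum imageE)

lemma tensor_sum_eq_iff:
  "(\<Sum>(x, y)\<leftarrow>ps. x \<otimes> y) = (\<Sum>(x, y)\<leftarrow>qs. x \<otimes> y) \<longleftrightarrow>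
   (\<forall>B :: 'a \<Rightarrow> 'b \<Rightarrow> real. bilinear B \<longrightarrow> (\<Sum>(x, y)\<leftarrow>ps. B x y) = (\<Sum>(x, y)\<leftarrow>qs. B x y))"
  for ps qs :: "('a::real_vector \<times> 'b::real_vector) list"
  unfolding Rep_tensor_inject[symmetric] Rep_tensor_sum
  by (auto simp: eval_pairs_def fun_eq_iff)

lemma bilinear_tensor: "bilinear (\<otimes>)"
proof -
  have [simp]: "bilinear B \<Longrightarrow> B (c *\<^sub>R x) y = c * B x y" "bilinear B \<Longrightarrow> B x (c *\<^sub>R y) = c * B x y"
    for B :: "'a \<Rightarrow> 'b \<Rightarrow> real" and c x y
    by (simp_all add: bilinear_lmul bilinear_rmul)
  show ?thesis
    unfolding bilinear_def
    by (intro conjI allI linearI; transfer)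
      (auto simp: eval_pairs_def fun_eq_iff bilinear_ladd bilinear_radd)
qed

lemma separating_linear_form:
  fixes v :: "'a::real_vector"
  assumes "v \<noteq> 0"
  obtains g :: "'a \<Rightarrow> real" where "linear g" "g v \<noteq> 0"
  using linear_independent_extend[of "{v}" "\<lambda>_. 1::real"] assms by auto

lemma linear_sum_pairs:
  assumes "linear g"
  shows "g (\<Sum>(x, y)\<leftarrow>ps. h x y) = (\<Sum>(x, y)\<leftarrow>ps. g (h x y))"
  by (induction ps) (auto simp: linear_0[OF assms] linear_add[OF assms])

theorem tensor_universal:
  fixes B :: "'a::real_vector \<Rightarrow> 'b::real_vector \<Rightarrow> 'c::real_vector"
  assumes B: "bilinear B"
  shows "\<exists>!L. linear L \<and> (\<forall>x y. L (x \<otimes> y) = B x y)"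
proof -
  let ?t = "\<lambda>ps::('a \<times> 'b) list. \<Sum>(x, y)\<leftarrow>ps. x \<otimes> y"
  let ?s = "\<lambda>ps::('a \<times> 'b) list. \<Sum>(x, y)\<leftarrow>ps. B x y"
  have well: "?s ps = ?s qs" if eq: "?t ps = ?t qs" for ps qs
  proof (rule ccontr)
    assume "?s ps \<noteq> ?s qs"
    then obtain g :: "'c \<Rightarrow> real" where g: "linear g" "g (?s ps - ?s qs) \<noteq> 0"
      using separating_linear_form[of "?s ps - ?s qs"] by auto
    have "bilinear (\<lambda>x y. g (B x y))"
      using B g(1) unfolding bilinear_def by (auto intro: linear_compose[unfolded o_def])
    then have "(\<Sum>(x, y)\<leftarrow>ps. g (B x y)) = (\<Sum>(x, y)\<leftarrow>qs. g (B x y))"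
      using eq unfolding tensor_sum_eq_iff by blast
    then show False using g by (simp add: linear_diff linear_sum_pairs)
  qed
  define L where "L z = ?s (SOME ps. z = ?t ps)" for z
  have L: "L (?t ps) = ?s ps" for ps
    unfolding L_def by (rule well) (rule sym, rule someI[of _ ps], rule refl)
  show ?thesis
  proof (intro ex1I conjI allI)
    show "linear L"
    proof (rule linearI)
      fix z w :: "('a, 'b) tensor" and c :: real
      obtain ps qs where z: "z = ?t ps" and w: "w = ?t qs" using tensor_representation by metis
      show "L (z + w) = L z + L w" using L[of "ps @ qs"] by (simp add: z w L)
      have "?t (map (\<lambda>(x, y). (c *\<^sub>R x, y)) ps) = c *\<^sub>R ?t ps"
        by (induction ps) (auto simp: bilinear_lmul[OF bilinear_tensor] algebra_simps)
      moreover have "?s (map (\<lambda>(x, y). (c *\<^sub>R x, y)) ps) = c *\<^sub>R ?s ps"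
        by (induction ps) (auto simp: bilinear_lmul[OF B] algebra_simps)
      ultimately show "L (c *\<^sub>R z) = c *\<^sub>R L z"
        using L[of "map (\<lambda>(x, y). (c *\<^sub>R x, y)) ps"] by (simp add: z L)
    qed
    show "L (x \<otimes> y) = B x y" for x y using L[of "[(x, y)]"] by simp
  next
    fix L' assume L': "linear L' \<and> (\<forall>x y. L' (x \<otimes> y) = B x y)"
    show "L' = L"
    proof
      fix z :: "('a, 'b) tensor"
      obtain ps where z: "z = ?t ps" by (rule tensor_representation)
      show "L' z = L z" using L' by (simp add: z L linear_sum_pairs)
    qed
  qed
qed

section \<open>The projective norm\<close>

instantiation tensor :: (real_normed_vector, real_normed_vector) real_normed_vector
begin

definition norm_tensor :: "('a, 'b) tensor \<Rightarrow> real" where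
  "norm z = Inf {(\<Sum>(x, y)\<leftarrow>ps. norm x * norm y) | ps. z = (\<Sum>(x, y)\<leftarrow>ps. x \<otimes> y)}"

definition sgn_tensor :: "('a, 'b) tensor \<Rightarrow> ('a, 'b) tensor" where
  "sgn_tensor z = z /\<^sub>R norm z"

definition dist_tensor :: "('a, 'b) tensor \<Rightarrow> ('a, 'b) tensor \<Rightarrow> real" where
  "dist_tensor z w = norm (z - w)"

definition uniformity_tensor :: "(('a, 'b) tensor \<times> ('a, 'b) tensor) filter" where
  "uniformity_tensor = (INF e\<in>{0 <..}. principal {(z, w). dist z w < e})"

definition open_tensor :: "('a, 'b) tensor set \<Rightarrow> bool" where
  "open_tensor S \<longleftrightarrow> (\<forall>z\<in>S. \<forall>\<^sub>F (z', w) in uniformity. z' = z \<longrightarrow> w \<in> S)"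

lemma sum_norms_nonneg:
  fixes ps :: "('c::real_normed_vector \<times> 'd::real_normed_vector) list"
  shows "0 \<le> (\<Sum>(x, y)\<leftarrow>ps. norm x * norm y)"
  by (induction ps) (auto intro!: add_nonneg_nonneg)

lemma norm_tensor_le:
  "norm ((\<Sum>(x, y)\<leftarrow>ps. x \<otimes> y) :: ('a, 'b) tensor) \<le> (\<Sum>(x, y)\<leftarrow>ps. norm x * norm y)"
  unfolding norm_tensor_def
  by (rule cInf_lower) (auto intro!: bdd_belowI[of _ 0] sum_norms_nonneg)

lemma norm_tensor_greatest:
  fixes z :: "('a, 'b) tensor"
  assumes "\<And>ps. z = (\<Sum>(x, y)\<leftarrow>ps. x \<otimes> y) \<Longrightarrow> c \<le> (\<Sum>(x, y)\<leftarrow>ps. norm x * norm y)"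
  shows "c \<le> norm z"
  unfolding norm_tensor_def
  using assms tensor_representation[of z] by (intro cInf_greatest) blast+

lemma norm_tensor_scale_le:
  fixes z :: "('a, 'b) tensor"
  shows "norm (c *\<^sub>R z) \<le> \<bar>c\<bar> * norm z"
proof (cases "c = 0")
  case True
  have "norm (0 :: ('a, 'b) tensor) \<le> 0" using norm_tensor_le[of "[]"] by simp
  with True show ?thesis by simp
next
  case False
  have "norm (c *\<^sub>R z) / \<bar>c\<bar> \<le> norm z"
  proof (rule norm_tensor_greatest)
    fix ps assume z: "z = (\<Sum>(x, y)\<leftarrow>ps. x \<otimes> y)"
    let ?qs = "map (\<lambda>(x, y). (c *\<^sub>R x, y)) ps"
    have 1: "(\<Sum>(x, y)\<leftarrow>?qs. x \<otimes> y) = c *\<^sub>R (\<Sum>(x, y)\<leftarrow>ps. x \<otimes> y)"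
      by (induction ps) (auto simp: bilinear_lmul[OF bilinear_tensor] algebra_simps)
    have 2: "(\<Sum>(x, y)\<leftarrow>?qs. norm x * norm y) = \<bar>c\<bar> * (\<Sum>(x, y)\<leftarrow>ps. norm x * norm y)"
      by (induction ps) (auto simp: algebra_simps)
    show "norm (c *\<^sub>R z) / \<bar>c\<bar> \<le> (\<Sum>(x, y)\<leftarrow>ps. norm x * norm y)"
      using norm_tensor_le[of ?qs] False unfolding 1 2 z by (simp add: field_simps)
  qed
  then show ?thesis using False by (simp add: field_simps)
qed

lemma norm_tensor_bound:
  fixes z :: "('a, 'b) tensor"
  assumes L: "linear L" and B: "\<And>x y. \<bar>L (x \<otimes> y)\<bar> \<le> norm x * norm y"
  shows "\<bar>L z\<bar> \<le> norm z"
proof (rule norm_tensor_greatest)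
  fix ps assume z: "z = (\<Sum>(x, y)\<leftarrow>ps. x \<otimes> y)"
  have "\<bar>\<Sum>(x, y)\<leftarrow>ps. L (x \<otimes> y)\<bar> \<le> (\<Sum>(x, y)\<leftarrow>ps. norm x * norm y)"
  proof (induction ps)
    case (Cons p ps)
    then show ?case
      using B[of "fst p" "snd p"] by (cases p) (auto intro: order_trans[OF abs_triangle_ineq add_mono])
  qed simp
  then show "\<bar>L z\<bar> \<le> (\<Sum>(x, y)\<leftarrow>ps. norm x * norm y)"
    by (simp add: z linear_sum_pairs[OF L])
qed

lemma tensor_basis_representation:
  fixes z :: "('a, 'b) tensor"
  obtains S v where "finite S" "independent S" "z = (\<Sum>b\<in>S. v b \<otimes> b)"
proof -
  obtain ps where z: "z = (\<Sum>(x, y)\<leftarrow>ps. x \<otimes> y)" by (rule tensor_representation)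
  obtain S where S: "S \<subseteq> snd ` set ps" "independent S" "snd ` set ps \<subseteq> span S"
    using maximal_independent_subset[of "snd ` set ps"] by blast
  then have fin: "finite S" by (auto intro: finite_subset)
  have "\<exists>v. (\<Sum>(x, y)\<leftarrow>ps. x \<otimes> y) = (\<Sum>b\<in>S. v b \<otimes> b)"
    using S(3)
  proof (induction ps)
    case Nil
    show ?case
      by (rule exI[of _ "\<lambda>_. 0"]) (simp add: bilinear_lzero[OF bilinear_tensor])
  next
    case (Cons p ps)
    obtain x y where p: "p = (x, y)" by force
    from Cons obtain v where v: "(\<Sum>(x, y)\<leftarrow>ps. x \<otimes> y) = (\<Sum>b\<in>S. v b \<otimes> b)" by auto
    from Cons.prems p have "y \<in> span S" by auto
    then obtain c where c: "y = (\<Sum>b\<in>S. c b *\<^sub>R b)" using span_finite[OF fin] by auto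
    have "x \<otimes> y = (\<Sum>b\<in>S. (c b *\<^sub>R x) \<otimes> b)"
    proof -
      have "linear ((\<otimes>) x :: 'b \<Rightarrow> ('a, 'b) tensor)" using bilinear_tensor[where 'a = 'a and 'b = 'b] by (simp add: bilinear_def)
      then show ?thesis
        unfolding c
        by (simp add: linear_sum bilinear_lmul[OF bilinear_tensor] bilinear_rmul[OF bilinear_tensor])
    qed
    then have "(\<Sum>(x, y)\<leftarrow>p # ps. x \<otimes> y) = (\<Sum>b\<in>S. (c b *\<^sub>R x + v b) \<otimes> b)"
      by (simp add: p v bilinear_ladd[OF bilinear_tensor] sum.distrib)
    then show ?case by (rule exI[of _ "\<lambda>b. c b *\<^sub>R x + v b"])
  qed
  then show ?thesis using that[OF fin S(2)] z by blast
qed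

lemma norm_tensor_eq_0D:
  fixes z :: "('a, 'b) tensor"
  assumes z0: "norm z = 0"
  shows "z = 0"
proof -
  obtain S v where S: "finite S" "independent S" and z: "z = (\<Sum>b\<in>S. v b \<otimes> b)"
    by (rule tensor_basis_representation)
  have "v b = 0" if b: "b \<in> S" for b
  proof -
    obtain f :: "'a \<Rightarrow> real" where f: "linear f" "\<And>x. \<bar>f x\<bar> \<le> norm x" "f (v b) = norm (v b)"
      using norming_functional by blast
    let ?w = "\<Sum>b\<in>S. f (v b) *\<^sub>R b"
    obtain g :: "'b \<Rightarrow> real" where g: "linear g" "\<And>y. \<bar>g y\<bar> \<le> norm y" "g ?w = norm ?w"
      using norming_functional by blast
    have "bilinear (\<lambda>x y. f x * g y)"
      using f(1) g(1) unfolding bilinear_def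
      by (auto intro!: linearI simp: linear_add linear_cmul algebra_simps)
    then obtain L where L: "linear L" "\<And>x y. L (x \<otimes> y) = f x * g y"
      using tensor_universal by blast
    have "\<bar>L z\<bar> \<le> norm z"
      using L f(2) g(2) by (intro norm_tensor_bound) (auto simp: abs_mult intro!: mult_mono)
    moreover have "L z = norm ?w"
      unfolding g(3)[symmetric] z by (simp add: linear_sum[OF L(1)] linear_sum[OF g(1)] L(2) linear_cmul[OF g(1)])
    ultimately have "?w = 0" using z0 by simp
    then have "f (v b) = 0" using independentD[OF S(2,1) order_refl, where u = "\<lambda>b. f (v b)"] b by simp
    with f(3) show "v b = 0" by simp
  qed
  then show ?thesis by (simp add: z bilinear_lzero[OF bilinear_tensor])
qed

instance
proof
  fix z w :: "('a, 'b) tensor" and c :: real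
  show "dist z w = norm (z - w)" by (rule dist_tensor_def)
  show "sgn z = z /\<^sub>R norm z" by (rule sgn_tensor_def)
  show "uniformity = (INF e\<in>{0 <..}. principal {(z :: ('a, 'b) tensor, w). dist z w < e})"
    by (rule uniformity_tensor_def)
  show "open S \<longleftrightarrow> (\<forall>z\<in>S. \<forall>\<^sub>F (z', w) in uniformity. z' = z \<longrightarrow> w \<in> S)" for S :: "('a, 'b) tensor set"
    by (rule open_tensor_def)
  have nonneg: "0 \<le> norm z" for z :: "('a, 'b) tensor"
    by (rule norm_tensor_greatest) (rule sum_norms_nonneg)
  show "norm z = 0 \<longleftrightarrow> z = 0"
    using norm_tensor_eq_0D[of z] norm_tensor_le[of "[]"] nonneg[of 0] by auto
  show "norm (z + w) \<le> norm z + norm w"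
  proof -
    have "norm (z + w) - norm w \<le> norm z"
    proof (rule norm_tensor_greatest)
      fix ps assume z: "z = (\<Sum>(x, y)\<leftarrow>ps. x \<otimes> y)"
      have "norm (z + w) - (\<Sum>(x, y)\<leftarrow>ps. norm x * norm y) \<le> norm w"
      proof (rule norm_tensor_greatest)
        fix qs assume w: "w = (\<Sum>(x, y)\<leftarrow>qs. x \<otimes> y)"
        show "norm (z + w) - (\<Sum>(x, y)\<leftarrow>ps. norm x * norm y) \<le> (\<Sum>(x, y)\<leftarrow>qs. norm x * norm y)"
          using norm_tensor_le[of "ps @ qs"] by (simp add: z w)
      qed
      then show "norm (z + w) - norm w \<le> (\<Sum>(x, y)\<leftarrow>ps. norm x * norm y)" by linarith
    qed
    then show ?thesis by linarith
  qed
  show "norm (c *\<^sub>R z) = \<bar>c\<bar> * norm z"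
  proof (cases "c = 0")
    case True
    have "norm (0 :: ('a, 'b) tensor) = 0" using norm_tensor_le[of "[]"] nonneg[of 0] by simp
    with True show ?thesis by simp
  next
    case False
    have "norm (inverse c *\<^sub>R c *\<^sub>R z) \<le> \<bar>inverse c\<bar> * norm (c *\<^sub>R z)"
      by (rule norm_tensor_scale_le)
    then have "\<bar>c\<bar> * norm z \<le> norm (c *\<^sub>R z)" using False by (simp add: field_simps)
    with norm_tensor_scale_le[of c z] show ?thesis by linarith
  qed
qed

end

section \<open>Completion of a normed space\<close>

definition cauchy_equiv :: "(nat \<Rightarrow> 'a::real_normed_vector) \<Rightarrow> (nat \<Rightarrow> 'a) \<Rightarrow> bool" where
  "cauchy_equiv X Y \<longleftrightarrow> Cauchy X \<and> Cauchy Y \<and> (\<lambda>n. X n - Y n) \<longlonglongrightarrow> 0"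

lemma Cauchy_const: "Cauchy (\<lambda>_. a :: 'a::real_normed_vector)"
  by (rule LIMSEQ_imp_Cauchy) (rule tendsto_const)

quotient_type (overloaded) 'a normed_completion =
  "nat \<Rightarrow> 'a::real_normed_vector" / partial: cauchy_equiv
proof (rule part_equivpI)
  show "\<exists>X. cauchy_equiv X X"
    by (rule exI[of _ "\<lambda>_. 0"]) (simp add: cauchy_equiv_def Cauchy_const)
  show "symp (cauchy_equiv :: (nat \<Rightarrow> 'a) \<Rightarrow> _)"
    unfolding symp_def
  proof (intro allI impI)
    fix X Y :: "nat \<Rightarrow> 'a" assume *: "cauchy_equiv X Y"
    then have "(\<lambda>n. - (X n - Y n)) \<longlonglongrightarrow> - 0"
      unfolding cauchy_equiv_def by (intro tendsto_minus) auto
    with * show "cauchy_equiv Y X" by (simp add: cauchy_equiv_def)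
  qed
  show "transp (cauchy_equiv :: (nat \<Rightarrow> 'a) \<Rightarrow> _)"
    unfolding transp_def
  proof (intro allI impI)
    fix X Y Z :: "nat \<Rightarrow> 'a" assume *: "cauchy_equiv X Y" "cauchy_equiv Y Z"
    then have "(\<lambda>n. (X n - Y n) + (Y n - Z n)) \<longlonglongrightarrow> 0 + 0"
      unfolding cauchy_equiv_def by (intro tendsto_add) auto
    with * show "cauchy_equiv X Z" by (simp add: cauchy_equiv_def)
  qed
qed

lemma Cauchy_bounded_linear:
  assumes "bounded_linear f" "Cauchy X"
  shows "Cauchy (\<lambda>n. f (X n))"
  using bounded_linear.Cauchy[OF assms] .

lemma Cauchy_plus:
  fixes X Y :: "nat \<Rightarrow> 'a::real_normed_vector"
  assumes "Cauchy X" "Cauchy Y"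
  shows "Cauchy (\<lambda>n. X n + Y n)"
proof (rule metric_CauchyI)
  fix e :: real assume "0 < e"
  then have e: "0 < e / 2" by simp
  obtain M N where M: "\<forall>m\<ge>M. \<forall>n\<ge>M. dist (X m) (X n) < e / 2"
    and N: "\<forall>m\<ge>N. \<forall>n\<ge>N. dist (Y m) (Y n) < e / 2"
    using metric_CauchyD[OF assms(1) e] metric_CauchyD[OF assms(2) e] by blast
  have "dist (X m + Y m) (X n + Y n) < e" if "m \<ge> max M N" "n \<ge> max M N" for m n
  proof -
    have "dist (X m) (X n) < e / 2" "dist (Y m) (Y n) < e / 2" using M N that by auto
    with dist_triangle_add[of "X m" "Y m" "X n" "Y n"] show ?thesis by linarith
  qed
  then show "\<exists>M. \<forall>m\<ge>M. \<forall>n\<ge>M. dist (X m + Y m) (X n + Y n) < e" by blast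
qed

lemma Cauchy_norm:
  fixes X :: "nat \<Rightarrow> 'a::real_normed_vector"
  assumes "Cauchy X"
  shows "(\<lambda>n. norm (X n)) \<longlonglongrightarrow> lim (\<lambda>n. norm (X n))"
proof -
  have "Cauchy (\<lambda>n. norm (X n))"
  proof (rule metric_CauchyI)
    fix e :: real assume "0 < e"
    then obtain M where M: "\<forall>m\<ge>M. \<forall>n\<ge>M. dist (X m) (X n) < e" using metric_CauchyD[OF assms] by blast
    have "dist (norm (X m)) (norm (X n)) < e" if "m \<ge> M" "n \<ge> M" for m n
    proof -
      have "norm (X m - X n) < e" using M that by (simp add: dist_norm)
      with norm_triangle_ineq3[of "X m" "X n"] show ?thesis by (simp add: dist_norm)
    qed
    then show "\<exists>M. \<forall>m\<ge>M. \<forall>n\<ge>M. dist (norm (X m)) (norm (X n)) < e" by blast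
  qed
  then show ?thesis by (metis Cauchy_convergent convergent_LIMSEQ_iff)
qed

instantiation normed_completion :: (real_normed_vector) real_vector
begin

lift_definition zero_normed_completion :: "'a normed_completion" is "\<lambda>n. 0"
  by (simp add: cauchy_equiv_def Cauchy_const)

lift_definition plus_normed_completion ::
  "'a normed_completion \<Rightarrow> 'a normed_completion \<Rightarrow> 'a normed_completion" is "\<lambda>X Y n. X n + Y n"
proof -
  fix X X' Y Y' :: "nat \<Rightarrow> 'a"
  assume *: "cauchy_equiv X X'" "cauchy_equiv Y Y'"
  then have "(\<lambda>n. (X n - X' n) + (Y n - Y' n)) \<longlonglongrightarrow> 0 + 0"
    unfolding cauchy_equiv_def by (intro tendsto_add) auto
  with * show "cauchy_equiv (\<lambda>n. X n + Y n) (\<lambda>n. X' n + Y' n)"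
    by (simp add: cauchy_equiv_def Cauchy_plus algebra_simps)
qed

lift_definition scaleR_normed_completion ::
  "real \<Rightarrow> 'a normed_completion \<Rightarrow> 'a normed_completion" is "\<lambda>c X n. c *\<^sub>R X n"
proof -
  fix c :: real and X Y :: "nat \<Rightarrow> 'a"
  assume *: "cauchy_equiv X Y"
  then have "(\<lambda>n. c *\<^sub>R (X n - Y n)) \<longlonglongrightarrow> c *\<^sub>R 0"
    unfolding cauchy_equiv_def by (intro tendsto_intros) auto
  with * show "cauchy_equiv (\<lambda>n. c *\<^sub>R X n) (\<lambda>n. c *\<^sub>R Y n)"
    by (simp add: cauchy_equiv_def Cauchy_bounded_linear[OF bounded_linear_scaleR_right]
        scaleR_right_diff_distrib)
qed

definition uminus_normed_completion :: "'a normed_completion \<Rightarrow> 'a normed_completion" where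
  "uminus_normed_completion z = (-1) *\<^sub>R z"

definition minus_normed_completion ::
    "'a normed_completion \<Rightarrow> 'a normed_completion \<Rightarrow> 'a normed_completion" where
  "minus_normed_completion z w = z + - w"

instance
proof
  fix x y z :: "'a normed_completion" and a b :: real
  note [simp] = cauchy_equiv_def Cauchy_plus Cauchy_const
    Cauchy_bounded_linear[OF bounded_linear_scaleR_right] Cauchy_bounded_linear[OF bounded_linear_minus]
  show "x + y + z = x + (y + z)" by transfer (simp add: algebra_simps)
  show "x + y = y + x" by transfer (simp add: algebra_simps)
  show "0 + x = x" by transfer simp
  show "- x + x = 0" unfolding uminus_normed_completion_def by transfer simp
  show "x - y = x + - y" by (rule minus_normed_completion_def)
  show "a *\<^sub>R (x + y) = a *\<^sub>R x + a *\<^sub>R y" by transfer (simp add: algebra_simps)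
  show "(a + b) *\<^sub>R x = a *\<^sub>R x + b *\<^sub>R x" by transfer (simp add: algebra_simps)
  show "a *\<^sub>R b *\<^sub>R x = (a * b) *\<^sub>R x" by transfer simp
  show "1 *\<^sub>R x = x" by transfer simp
qed

end

instantiation normed_completion :: (real_normed_vector) real_normed_vector
begin

lift_definition norm_normed_completion :: "'a normed_completion \<Rightarrow> real" is "\<lambda>X. lim (\<lambda>n. norm (X n))"
proof -
  fix X Y :: "nat \<Rightarrow> 'a"
  assume *: "cauchy_equiv X Y"
  then have "(\<lambda>n. norm (X n - Y n)) \<longlonglongrightarrow> 0"
    by (simp add: cauchy_equiv_def tendsto_norm_zero_iff)
  then have "(\<lambda>n. norm (X n) - norm (Y n)) \<longlonglongrightarrow> 0"
    by (rule Lim_null_comparison[rotated]) (simp add: norm_triangle_ineq3)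
  moreover have "(\<lambda>n. norm (X n) - norm (Y n)) \<longlonglongrightarrow> lim (\<lambda>n. norm (X n)) - lim (\<lambda>n. norm (Y n))"
    using * by (intro tendsto_diff Cauchy_norm) (auto simp: cauchy_equiv_def)
  ultimately show "lim (\<lambda>n. norm (X n)) = lim (\<lambda>n. norm (Y n))"
    using LIMSEQ_unique by fastforce
qed

definition sgn_normed_completion :: "'a normed_completion \<Rightarrow> 'a normed_completion" where
  "sgn_normed_completion z = z /\<^sub>R norm z"

definition dist_normed_completion :: "'a normed_completion \<Rightarrow> 'a normed_completion \<Rightarrow> real" where
  "dist_normed_completion z w = norm (z - w)"

definition uniformity_normed_completion ::
    "('a normed_completion \<times> 'a normed_completion) filter" where
  "uniformity_normed_completion = (INF e\<in>{0 <..}. principal {(z, w). dist z w < e})"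

definition open_normed_completion :: "'a normed_completion set \<Rightarrow> bool" where
  "open_normed_completion S \<longleftrightarrow> (\<forall>z\<in>S. \<forall>\<^sub>F (z', w) in uniformity. z' = z \<longrightarrow> w \<in> S)"

instance
proof
  fix x y :: "'a normed_completion" and a :: real
  note [simp] = cauchy_equiv_def
  show "dist x y = norm (x - y)" by (rule dist_normed_completion_def)
  show "sgn x = x /\<^sub>R norm x" by (rule sgn_normed_completion_def)
  show "uniformity = (INF e\<in>{0 <..}. principal {(z :: 'a normed_completion, w). dist z w < e})"
    by (rule uniformity_normed_completion_def)
  show "open S \<longleftrightarrow> (\<forall>z\<in>S. \<forall>\<^sub>F (z', w) in uniformity. z' = z \<longrightarrow> w \<in> S)" for S :: "'a normed_completion set"
    by (rule open_normed_completion_def)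
  show "norm x = 0 \<longleftrightarrow> x = 0"
  proof transfer
    fix X :: "nat \<Rightarrow> 'a" assume "cauchy_equiv X X"
    then have X: "Cauchy X" by simp
    have "lim (\<lambda>n. norm (X n)) = 0 \<longleftrightarrow> (\<lambda>n. norm (X n)) \<longlonglongrightarrow> 0"
      using Cauchy_norm[OF X] by (auto dest: limI)
    with X show "lim (\<lambda>n. norm (X n)) = 0 \<longleftrightarrow> cauchy_equiv X (\<lambda>n. 0)"
      by (simp add: tendsto_norm_zero_iff Cauchy_const)
  qed
  show "norm (x + y) \<le> norm x + norm y"
  proof transfer
    fix X Y :: "nat \<Rightarrow> 'a" assume "cauchy_equiv X X" "cauchy_equiv Y Y"
    then have X: "Cauchy X" and Y: "Cauchy Y" by auto
    show "lim (\<lambda>n. norm (X n + Y n)) \<le> lim (\<lambda>n. norm (X n)) + lim (\<lambda>n. norm (Y n))"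
      by (rule LIMSEQ_le[OF Cauchy_norm[OF Cauchy_plus[OF X Y]] tendsto_add[OF Cauchy_norm[OF X] Cauchy_norm[OF Y]]])
        (auto intro: norm_triangle_ineq)
  qed
  show "norm (a *\<^sub>R x) = \<bar>a\<bar> * norm x"
  proof transfer
    fix c :: real and X :: "nat \<Rightarrow> 'a" assume "cauchy_equiv X X"
    then have X: "Cauchy X" by simp
    show "lim (\<lambda>n. norm (c *\<^sub>R X n)) = \<bar>c\<bar> * lim (\<lambda>n. norm (X n))"
      using tendsto_mult_left[OF Cauchy_norm[OF X], of "\<bar>c\<bar>"] by (auto intro: limI)
  qed
qed

end

lift_definition embed_completion :: "'a::real_normed_vector \<Rightarrow> 'a normed_completion" is "\<lambda>a n. a"
  by (simp add: cauchy_equiv_def Cauchy_const)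

lemma norm_embed_completion: "norm (embed_completion a) = norm a"
  by transfer (rule limI, rule tendsto_const)

lemma linear_embed_completion: "linear embed_completion"
  by (intro linearI; transfer)
    (simp_all add: cauchy_equiv_def Cauchy_const)

lemma dist_embed_completion: "dist (embed_completion a) (embed_completion b) = dist a b"
  by (simp add: dist_norm norm_embed_completion flip: linear_diff[OF linear_embed_completion])

lemma embed_completion_LIMSEQ:
  assumes X: "Cauchy X"
  shows "(\<lambda>n. embed_completion (X n)) \<longlonglongrightarrow> abs_normed_completion X"
proof (rule metric_LIMSEQ_I)
  fix e :: real assume "0 < e"
  then have e: "0 < e / 2" by simp
  obtain M where M: "\<forall>m\<ge>M. \<forall>n\<ge>M. dist (X m) (X n) < e / 2" using metric_CauchyD[OF X e] by blast
  have XX: "cauchy_equiv X X" using X by (simp add: cauchy_equiv_def)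
  have "dist (embed_completion (X m)) (abs_normed_completion X) < e" if m: "m \<ge> M" for m
  proof -
    have C: "Cauchy (\<lambda>n. X m + (-1) *\<^sub>R X n)"
      using X by (intro Cauchy_plus Cauchy_const Cauchy_bounded_linear[OF bounded_linear_scaleR_right])
    have XX1: "cauchy_equiv (\<lambda>n. (-1) *\<^sub>R X n) (\<lambda>n. (-1) *\<^sub>R X n)"
      using Cauchy_bounded_linear[OF bounded_linear_scaleR_right X, of "-1"] by (simp add: cauchy_equiv_def)
    have Xm: "cauchy_equiv (\<lambda>_. X m) (\<lambda>_. X m)" by (simp add: cauchy_equiv_def Cauchy_const)
    have "embed_completion (X m) - abs_normed_completion X = abs_normed_completion (\<lambda>n. X m + (-1) *\<^sub>R X n)"
      unfolding minus_normed_completion_def uminus_normed_completion_def embed_completion.abs_eq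
        scaleR_normed_completion.abs_eq[OF XX] plus_normed_completion.abs_eq[OF XX1 Xm]
        plus_normed_completion.abs_eq[OF Xm XX1] ..
    moreover have "cauchy_equiv (\<lambda>n. X m + (-1) *\<^sub>R X n) (\<lambda>n. X m + (-1) *\<^sub>R X n)"
      using C by (simp add: cauchy_equiv_def)
    ultimately have "dist (embed_completion (X m)) (abs_normed_completion X) =
        lim (\<lambda>n. norm (X m + (-1) *\<^sub>R X n))"
      by (simp only: dist_norm norm_normed_completion.abs_eq)
    also have "\<dots> \<le> e / 2"
    proof (rule LIMSEQ_le_const2[OF Cauchy_norm[OF C]])
      show "\<exists>N. \<forall>n\<ge>N. norm (X m + (-1) *\<^sub>R X n) \<le> e / 2"
        using M m by (intro exI[of _ M]) (auto simp: dist_norm less_imp_le)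
    qed
    finally show ?thesis using \<open>0 < e\<close> by simp
  qed
  then show "\<exists>no. \<forall>n\<ge>no. dist (embed_completion (X n)) (abs_normed_completion X) < e" by blast
qed

lemma closure_range_embed_completion: "closure (range embed_completion) = UNIV"
proof -
  have "z \<in> closure (range embed_completion)" for z :: "'a normed_completion"
  proof (induction z rule: normed_completion.abs_induct)
    case (1 X)
    then have "(\<lambda>n. embed_completion (X n)) \<longlonglongrightarrow> abs_normed_completion X"
      by (intro embed_completion_LIMSEQ) (simp add: cauchy_equiv_def)
    then show ?case
      unfolding closure_sequential by (intro exI[of _ "\<lambda>n. embed_completion (X n)"]) simp
  qed
  then show ?thesis by auto
qed

instance normed_completion :: (real_normed_vector) banach
proof
  fix F :: "nat \<Rightarrow> 'a normed_completion"
  assume F: "Cauchy F"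
  have "\<exists>a. dist (embed_completion a) (F n) < inverse (Suc n)" for n
  proof -
    have "F n \<in> closure (range embed_completion)" by (simp add: closure_range_embed_completion)
    moreover have "0 < inverse (real (Suc n))" by simp
    ultimately show ?thesis unfolding closure_approachable by blast
  qed
  then obtain a where a: "\<And>n. dist (embed_completion (a n)) (F n) < inverse (Suc n)" by metis
  have diff: "(\<lambda>n. embed_completion (a n) - F n) \<longlonglongrightarrow> 0"
    by (rule Lim_null_comparison[OF _ LIMSEQ_inverse_real_of_nat])
      (use a in \<open>auto simp: dist_norm intro!: always_eventually less_imp_le\<close>)
  have "Cauchy (\<lambda>n. F n + (embed_completion (a n) - F n))"
    by (rule Cauchy_plus[OF F LIMSEQ_imp_Cauchy[OF diff]])
  then have "Cauchy a" by (simp add: Cauchy_def dist_embed_completion)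
  then have "(\<lambda>n. embed_completion (a n)) \<longlonglongrightarrow> abs_normed_completion a"
    by (rule embed_completion_LIMSEQ)
  from tendsto_diff[OF this diff] have "F \<longlonglongrightarrow> abs_normed_completion a" by simp
  then show "convergent F" by (rule convergentI)
qed

section \<open>The projective tensor product and norm attainment\<close>

type_synonym ('a, 'b) proj_tensor = "('a, 'b) tensor normed_completion"

abbreviation ptensor :: "'a::real_normed_vector \<Rightarrow> 'b::real_normed_vector \<Rightarrow> ('a, 'b) proj_tensor"
    (infixl "\<otimes>\<^sub>\<pi>" 70) where
  "x \<otimes>\<^sub>\<pi> y \<equiv> embed_completion (x \<otimes> y)"

definition attains_projective_norm ::
    "('a::real_normed_vector, 'b::real_normed_vector) proj_tensor \<Rightarrow> bool" where
  "attains_projective_norm z \<longleftrightarrow>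
    (\<exists>(x :: nat \<Rightarrow> 'a) (y :: nat \<Rightarrow> 'b).
      bounded (range (\<lambda>n. (x n, y n))) \<and>
      summable (\<lambda>n. norm (x n) * norm (y n)) \<and>
      (\<lambda>n. x n \<otimes>\<^sub>\<pi> y n) sums z \<and>
      norm z = (\<Sum>n. norm (x n) * norm (y n)))"

definition NA_proj :: "('a::real_normed_vector, 'b::real_normed_vector) proj_tensor set" where
  "NA_proj = {z. attains_projective_norm z}"

section \<open>Geometry of Banach spaces\<close>

definition finite_dim_subspace :: "'a::real_vector set \<Rightarrow> bool" where
  "finite_dim_subspace M \<longleftrightarrow> (\<exists>B. finite B \<and> span B = M)"

definition polyhedral_space :: "'a::real_normed_vector itself \<Rightarrow> bool" where
  "polyhedral_space _ \<longleftrightarrow>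
    (\<forall>M :: 'a set. finite_dim_subspace M \<longrightarrow> polytope (cball 0 1 \<inter> M))"

definition one_complemented :: "'a::real_normed_vector set \<Rightarrow> bool" where
  "one_complemented M \<longleftrightarrow>
    (\<exists>P :: 'a \<Rightarrow> 'a. bounded_linear P \<and> P \<circ> P = P \<and> onorm P = 1 \<and> range P = M)"

text \<open>The finite set is taken nonempty, which only matters for the zero space: it has an empty unit
  sphere and no projection of norm one, and the property holds for it vacuously.\<close>

definition metric_pi_property :: "'a::real_normed_vector itself \<Rightarrow> bool" where
  "metric_pi_property _ \<longleftrightarrow>
    (\<forall>\<epsilon>>0. \<forall>F :: 'a set. finite F \<and> F \<noteq> {} \<and> F \<subseteq> sphere 0 1 \<longrightarrow>
      (\<exists>M. finite_dim_subspace M \<and> one_complemented M \<and> (\<forall>x\<in>F. \<exists>x'\<in>M. norm (x - x') < \<epsilon>)))"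

definition isometric_isomorphism :: "('a::real_normed_vector \<Rightarrow> 'b::real_normed_vector) \<Rightarrow> bool" where
  "isometric_isomorphism J \<longleftrightarrow> linear J \<and> bij J \<and> (\<forall>x. norm (J x) = norm x)"

end

theory Submission
  imports Defs
begin

text \<open>By the metric \<open>\<pi>\<close>-property and density, it suffices to treat tensors \<open>u\<close> in \<open>M \<otimes> Y\<close>, where
  \<open>M\<close> is the range of a norm-one projection \<open>P\<close> and its unit ball is the convex hull of a finite set \<open>V\<close>.
  Applying \<open>P\<close> to the left factors of an almost optimal representation of \<open>u\<close> and expanding them
  over \<open>V\<close> rewrites it, at no cost in norm, as \<open>u = \<Sum>v\<in>V. v \<otimes> y v\<close> with \<open>\<Sum>v\<in>V. norm (y v)\<close> close
  to \<open>norm u\<close>. The index set \<open>V\<close> no longer depends on the representation, so weak* compactness in \<open>Y\<close>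
  provides a minimizer, which attains the norm. Only a generalised limit is needed from
  compactness, and it is obtained from a linear functional dominated by the limit superior.\<close>

section \<open>Generalised limits of bounded real sequences\<close>

lemma Bseq_plus:
  fixes x y :: "nat \<Rightarrow> 'a::real_normed_vector"
  shows "Bseq x \<Longrightarrow> Bseq y \<Longrightarrow> Bseq (\<lambda>n. x n + y n)"
  unfolding Bseq_eq_bounded by (rule bounded_plus_comp)

text \<open>The limit superior is sublinear on the bounded sequences, so some linear functional lies
  below it. Sequences are handled as bounded continuous functions on the discrete space of naturals,
  which form a vector space type to which the domination lemma applies.\<close>

lemma banach_limit_exists:
  obtains L :: "(nat \<Rightarrow> real) \<Rightarrow> real" where
    "\<And>x y. Bseq x \<Longrightarrow> Bseq y \<Longrightarrow> L (\<lambda>n. x n + y n) = L x + L y"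
    "\<And>c x. Bseq x \<Longrightarrow> L (\<lambda>n. c * x n) = c * L x"
    "\<And>x c. Bseq x \<Longrightarrow> eventually (\<lambda>n. x n \<le> c) sequentially \<Longrightarrow> L x \<le> c"
proof -
  \<comment> \<open>\<open>U x\<close> collects the eventual upper bounds of \<open>x\<close>, so
    its infimum \<open>p x\<close> is the limit superior.\<close>
  define U where "U x = {c. eventually (\<lambda>n. apply_bcontfun x n \<le> c) sequentially}"
    for x :: "nat \<Rightarrow>\<^sub>C real"
  define p where "p x = Inf (U x)" for x
  have bound: "\<bar>apply_bcontfun x n\<bar> \<le> norm x" for x :: "nat \<Rightarrow>\<^sub>C real" and n
    using norm_bounded[of x n] by simp
  have "- norm x \<le> c" if "c \<in> U x" for x c
  proof -
    from that obtain n where "apply_bcontfun x n \<le> c"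
      unfolding U_def eventually_sequentially by blast
    then show ?thesis using bound[of x n] by linarith
  qed
  then have "bdd_below (U x)" for x by (auto intro!: bdd_belowI)
  then have lower: "p x \<le> c" if "c \<in> U x" for x c
    unfolding p_def using that by (intro cInf_lower)
  have "norm x \<in> U x" for x unfolding U_def using bound[of x] by (auto simp: abs_le_iff)
  then have greatest: "c \<le> p x" if "\<And>d. d \<in> U x \<Longrightarrow> c \<le> d" for x c
    unfolding p_def using that by (intro cInf_greatest) auto
  have add: "p (x + y) \<le> p x + p y" for x y
  proof -
    have "p (x + y) - p y \<le> c" if c: "c \<in> U x" for c
    proof -
      have "p (x + y) - c \<le> d" if d: "d \<in> U y" for d
      proof -
        have "c + d \<in> U (x + y)"
          using c d unfolding U_def by (auto simp: plus_bcontfun.rep_eq elim: eventually_elim2)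
        from lower[OF this] show ?thesis by linarith
      qed
      from greatest[of y, OF this] show ?thesis by linarith
    qed
    from greatest[of x, OF this] show ?thesis by linarith
  qed
  have scale_le: "c * p x \<le> p (c *\<^sub>R x)" if c: "0 < c" for c x
  proof (rule greatest)
    fix d assume "d \<in> U (c *\<^sub>R x)"
    then have "d / c \<in> U x"
      using c unfolding U_def by (simp add: scaleR_bcontfun.rep_eq field_simps)
    from lower[OF this] show "c * p x \<le> d" using c by (simp add: field_simps)
  qed
  have zero: "p 0 = 0"
  proof (rule antisym)
    show "p 0 \<le> 0" by (rule lower) (simp add: U_def)
    show "0 \<le> p 0" by (rule greatest) (simp add: U_def)
  qed
  have scale: "p (c *\<^sub>R x) = c * p x" if c: "0 \<le> c" for c x
  proof (cases "c = 0")
    case False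
    then have "inverse c * p (c *\<^sub>R x) \<le> p (inverse c *\<^sub>R c *\<^sub>R x)"
      using c by (intro scale_le) auto
    then have "p (c *\<^sub>R x) \<le> c * p x" using c False by (simp add: field_simps)
    with scale_le[of c x] c False show ?thesis by simp
  qed (simp add: zero)
  have "sublinear p" using add scale by (auto simp: sublinear_def)
  then obtain f where f: "linear f" "f \<le> p" by (rule sublinear_dominates_linear)
  have app: "apply_bcontfun (Bcontfun x) = x" if "Bseq x" for x :: "nat \<Rightarrow> real"
    using that by (intro Bcontfun_inverse)
      (auto simp: bcontfun_def continuous_on_discrete Bseq_eq_bounded)
  show ?thesis
  proof
    fix x y :: "nat \<Rightarrow> real" and c :: real
    assume x: "Bseq x"
    show "f (Bcontfun (\<lambda>n. c * x n)) = c * f (Bcontfun x)"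
    proof -
      have "Bseq (\<lambda>n. c * x n)" using x Bseq_mult[of "\<lambda>_. c" x] by simp
      then have "Bcontfun (\<lambda>n. c * x n) = c *\<^sub>R Bcontfun x"
        using x by (intro bcontfun_eqI) (simp add: app scaleR_bcontfun.rep_eq)
      then show ?thesis by (simp add: linear_cmul[OF f(1)])
    qed
    show "f (Bcontfun x) \<le> c" if "eventually (\<lambda>n. x n \<le> c) sequentially"
      using that lower[of c "Bcontfun x"] le_funD[OF f(2), of "Bcontfun x"]
      by (simp add: U_def app[OF x])
    assume y: "Bseq y"
    show "f (Bcontfun (\<lambda>n. x n + y n)) = f (Bcontfun x) + f (Bcontfun y)"
    proof -
      have "Bcontfun (\<lambda>n. x n + y n) = Bcontfun x + Bcontfun y"
        using x y Bseq_plus[of x y]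
        by (intro bcontfun_eqI) (simp add: app Bseq_plus plus_bcontfun.rep_eq)
      then show ?thesis by (simp add: linear_add[OF f(1)])
    qed
  qed
qed

section \<open>Tensors expanded over the generators of a polytopal ball\<close>

text \<open>An enumeration of \<open>V\<close>, padded with zeros, turns the finite sum into the
  series required by norm attainment. The reverse of the assumed inequality holds for every
  representation, so the two sides are equal.\<close>

lemma attains_projective_norm_finite_sum:
  fixes y :: "'a::real_normed_vector \<Rightarrow> 'b::real_normed_vector"
  assumes V: "finite V" and le: "(\<Sum>v\<in>V. norm v * norm (y v)) \<le> norm (\<Sum>v\<in>V. v \<otimes> y v)"
  shows "attains_projective_norm (embed_completion (\<Sum>v\<in>V. v \<otimes> y v))"
proof -
  obtain vs where vs: "set vs = V" "distinct vs" using finite_distinct_list[OF V] by blast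
  define k where "k = length vs"
  define x where "x n = (if n < k then vs ! n else 0)" for n
  define w where "w n = (if n < k then y (vs ! n) else 0)" for n
  have reindex: "(\<Sum>n<k. h (vs ! n)) = (\<Sum>v\<in>V. h v)" for h :: "'a \<Rightarrow> 'c::comm_monoid_add"
    unfolding k_def vs(1)[symmetric]
    by (rule sum.reindex_bij_betw, rule bij_betw_nth[OF vs(2)]) auto
  have b: "bounded (range (\<lambda>n. (x n, w n)))"
  proof (rule bounded_subset)
    show "bounded (insert (0, 0) ((\<lambda>n. (vs ! n, y (vs ! n))) ` {..<k}))"
      by (intro finite_imp_bounded) simp
    show "range (\<lambda>n. (x n, w n)) \<subseteq> insert (0, 0) ((\<lambda>n. (vs ! n, y (vs ! n))) ` {..<k})"
      by (auto simp: x_def w_def)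
  qed
  have norms: "(\<lambda>n. norm (x n) * norm (w n)) sums (\<Sum>v\<in>V. norm v * norm (y v))"
    using sums_finite[of "{..<k}" "\<lambda>n. norm (x n) * norm (w n)"]
    by (simp add: x_def w_def flip: reindex)
  have sums: "(\<lambda>n. x n \<otimes>\<^sub>\<pi> w n) sums embed_completion (\<Sum>v\<in>V. v \<otimes> y v)"
    using sums_finite[of "{..<k}" "\<lambda>n. x n \<otimes>\<^sub>\<pi> w n"]
    by (simp add: x_def w_def bilinear_lzero[OF bilinear_tensor]
        linear_0[OF linear_embed_completion] linear_sum[OF linear_embed_completion] flip: reindex)
  have "norm (\<Sum>v\<in>V. v \<otimes> y v) \<le> (\<Sum>v\<in>V. norm v * norm (y v))"
    using norm_tensor_le[of "map (\<lambda>v. (v, y v)) vs"] vs by (simp add: o_def sum_list_distinct_conv_sum_set)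
  with le have "norm (embed_completion (\<Sum>v\<in>V. v \<otimes> y v)) = (\<Sum>v\<in>V. norm v * norm (y v))"
    by (simp add: norm_embed_completion)
  with b norms sums show ?thesis
    unfolding attains_projective_norm_def
    by (intro exI[of _ x] exI[of _ w]) (simp add: sums_unique[OF norms] sums_summable)
qed

text \<open>The normalised vector is a convex combination of \<open>V\<close>; multiplying its
  weights by \<open>norm x\<close> makes them sum to \<open>norm x\<close>.\<close>

lemma nonneg_combination_of_ball_generators:
  assumes V: "finite V" "cball 0 1 \<inter> M = convex hull V" and M: "subspace M" "x \<in> M"
  obtains c where "\<And>v. v \<in> V \<Longrightarrow> 0 \<le> c v" "sum c V = norm x" "x = (\<Sum>v\<in>V. c v *\<^sub>R v)"
proof (cases "x = 0")
  case True
  show ?thesis by (rule that[of "\<lambda>_. 0"]) (auto simp: True)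
next
  case False
  have "x /\<^sub>R norm x \<in> cball 0 1 \<inter> M" using M False by (auto intro: subspace_scale)
  then obtain u where u: "\<forall>v\<in>V. 0 \<le> u v" "sum u V = 1" "(\<Sum>v\<in>V. u v *\<^sub>R v) = x /\<^sub>R norm x"
    unfolding V(2) convex_hull_finite[OF V(1)] by blast
  show ?thesis
  proof (rule that[of "\<lambda>v. norm x * u v"])
    show "x = (\<Sum>v\<in>V. (norm x * u v) *\<^sub>R v)"
      using u(3) False by (simp flip: scaleR_scaleR scaleR_sum_right) (simp add: scaleR_scaleR)
  qed (use u in \<open>auto simp flip: sum_distrib_left\<close>)
qed

text \<open>The weights of each left factor \<open>a\<close> are moved to the right factor. Since
  they are nonnegative with sum \<open>norm a\<close>, the new right factors of
  \<open>a \<otimes> b\<close> have total norm \<open>norm a * norm b\<close>, and collecting them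
  by generator can only lower the total.\<close>

lemma tensor_sum_over_ball_generators:
  fixes ps :: "('a::real_normed_vector \<times> 'b::real_normed_vector) list"
  assumes V: "finite V" "cball 0 1 \<inter> M = convex hull V" and M: "subspace M" "fst ` set ps \<subseteq> M"
  obtains y where "(\<Sum>(a, b)\<leftarrow>ps. a \<otimes> b) = (\<Sum>v\<in>V. v \<otimes> y v)"
    "(\<Sum>v\<in>V. norm (y v)) \<le> (\<Sum>(a, b)\<leftarrow>ps. norm a * norm b)"
proof -
  have "\<exists>y. (\<Sum>(a, b)\<leftarrow>ps. a \<otimes> b) = (\<Sum>v\<in>V. v \<otimes> y v) \<and>
    (\<Sum>v\<in>V. norm (y v)) \<le> (\<Sum>(a, b)\<leftarrow>ps. norm a * norm b)"
    using M(2)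
  proof (induction ps)
    case Nil
    show ?case by (rule exI[of _ "\<lambda>_. 0"]) (simp add: bilinear_rzero[OF bilinear_tensor])
  next
    case (Cons p ps)
    obtain a b where p: "p = (a, b)" by force
    from Cons obtain y where y: "(\<Sum>(a, b)\<leftarrow>ps. a \<otimes> b) = (\<Sum>v\<in>V. v \<otimes> y v)"
      "(\<Sum>v\<in>V. norm (y v)) \<le> (\<Sum>(a, b)\<leftarrow>ps. norm a * norm b)" by auto
    have "a \<in> M" using Cons.prems p by simp
    then obtain c where c: "\<And>v. v \<in> V \<Longrightarrow> 0 \<le> c v" "sum c V = norm a" "a = (\<Sum>v\<in>V. c v *\<^sub>R v)"
      using nonneg_combination_of_ball_generators[OF V M(1)] by blast
    have "a \<otimes> b = (\<Sum>v\<in>V. v \<otimes> (c v *\<^sub>R b))"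
    proof -
      have "linear (\<lambda>a :: 'a. a \<otimes> b)"
        using bilinear_tensor[where 'a = 'a and 'b = 'b] by (simp add: bilinear_def)
      from linear_sum[OF this, of "\<lambda>v. c v *\<^sub>R v" V] show ?thesis
        unfolding c(3)[symmetric]
        by (simp add: bilinear_lmul[OF bilinear_tensor] bilinear_rmul[OF bilinear_tensor])
    qed
    moreover have "(\<Sum>v\<in>V. norm (c v *\<^sub>R b + y v)) \<le> norm a * norm b + (\<Sum>v\<in>V. norm (y v))"
    proof -
      have "(\<Sum>v\<in>V. norm (c v *\<^sub>R b + y v)) \<le> (\<Sum>v\<in>V. c v * norm b + norm (y v))"
        using c(1) by (intro sum_mono norm_triangle_le) simp
      then show ?thesis by (simp add: sum.distrib c(2) flip: sum_distrib_right)
    qed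
    ultimately show ?case
      using y by (intro exI[of _ "\<lambda>v. c v *\<^sub>R b + y v"])
        (auto simp: p bilinear_radd[OF bilinear_tensor] sum.distrib)
  qed
  then show ?thesis using that by blast
qed

text \<open>A nearly optimal representation of \<open>u\<close> may have left factors outside
  \<open>M\<close>. Applying \<open>P\<close> to them leaves \<open>u\<close> unchanged and does not
  raise the cost, after which they can be expanded over \<open>V\<close>.\<close>

lemma tensor_near_optimal_over_ball_generators:
  fixes u :: "('a::real_normed_vector, 'b::real_normed_vector) tensor"
  assumes V: "finite V" "cball 0 1 \<inter> M = convex hull V" and M: "one_complemented M"
    and u: "u = (\<Sum>(a, b)\<leftarrow>ps. a \<otimes> b)" "fst ` set ps \<subseteq> M" and e: "0 < e"
  obtains y where "u = (\<Sum>v\<in>V. v \<otimes> y v)" "(\<Sum>v\<in>V. norm (y v)) < norm u + e"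
proof -
  obtain P where P: "bounded_linear P" "P \<circ> P = P" "onorm P = 1" "range P = M"
    using M unfolding one_complemented_def by blast
  interpret P: bounded_linear P by fact
  have sub: "subspace M"
    unfolding P(4)[symmetric] by (intro linear_subspace_image P.linear_axioms subspace_UNIV)
  have fixed: "P a = a" if "a \<in> M" for a using that P(2,4) by (metis comp_apply imageE)
  obtain qs where qs: "u = (\<Sum>(a, b)\<leftarrow>qs. a \<otimes> b)" "(\<Sum>(a, b)\<leftarrow>qs. norm a * norm b) < norm u + e"
    using norm_tensor_greatest[of u "norm u + e"] e by fastforce
  \<comment> \<open>The map \<open>T\<close> obtained from this is the tensor product of
    \<open>P\<close> with the identity.\<close>
  have "bilinear (\<lambda>a b. P a \<otimes> b :: ('a, 'b) tensor)"
    unfolding bilinear_def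
    by (auto intro!: linearI simp: P.add P.scaleR bilinear_ladd[OF bilinear_tensor]
        bilinear_radd[OF bilinear_tensor] bilinear_lmul[OF bilinear_tensor] bilinear_rmul[OF bilinear_tensor])
  then obtain T :: "('a, 'b) tensor \<Rightarrow> ('a, 'b) tensor"
    where T: "linear T" "\<And>a b. T (a \<otimes> b) = P a \<otimes> b"
    using tensor_universal by blast
  have "T u = u"
    unfolding u(1) linear_sum_pairs[OF T(1)] T(2) using u(2) fixed
    by (intro arg_cong[of _ _ sum_list] map_cong) auto
  moreover define rs where "rs = map (\<lambda>(a, b). (P a, b)) qs"
  have "T u = (\<Sum>(a, b)\<leftarrow>rs. a \<otimes> b)"
    unfolding qs(1) linear_sum_pairs[OF T(1)] T(2) by (simp add: rs_def o_def case_prod_unfold)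
  ultimately have u_rs: "u = (\<Sum>(a, b)\<leftarrow>rs. a \<otimes> b)" by simp
  have "fst ` set rs \<subseteq> M" using P(4) by (auto simp: rs_def)
  then obtain y where y: "u = (\<Sum>v\<in>V. v \<otimes> y v)"
    "(\<Sum>v\<in>V. norm (y v)) \<le> (\<Sum>(a, b)\<leftarrow>rs. norm a * norm b)"
    unfolding u_rs by (rule tensor_sum_over_ball_generators[OF V sub])
  have "norm (P a) \<le> norm a" for a using onorm[OF P(1), of a] P(3) by simp
  then have "(\<Sum>(a, b)\<leftarrow>rs. norm a * norm b) \<le> (\<Sum>(a, b)\<leftarrow>qs. norm a * norm b)"
    by (auto simp: rs_def o_def case_prod_unfold intro!: sum_list_mono mult_right_mono)
  with y qs(2) that show ?thesis by fastforce
qed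

section \<open>Equality of tensors through contractions of the left factor\<close>

text \<open>Expanding the left factors in a basis \<open>D\<close> with coordinate functionals
  \<open>f d\<close> shows that the contractions by the \<open>f d\<close> determine the tensor.
  Equality thus becomes a set of linear relations between the right factors, a form that survives
  passage to a limit.\<close>

lemma tensor_eqI_of_contractions:
  fixes y y' :: "'a::real_vector \<Rightarrow> 'b::real_vector"
  assumes V: "finite V" "V \<subseteq> span B" "finite B"
    and eq: "\<And>f :: 'a \<Rightarrow> real. linear f \<Longrightarrow> (\<Sum>v\<in>V. f v *\<^sub>R y v) = (\<Sum>v\<in>V. f v *\<^sub>R y' v)"
  shows "(\<Sum>v\<in>V. v \<otimes> y v) = (\<Sum>v\<in>V. v \<otimes> y' v)"
proof -
  obtain D where D: "D \<subseteq> B" "independent D" "B \<subseteq> span D"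
    using maximal_independent_subset[of B] by blast
  then have fin: "finite D" and span: "span B \<subseteq> span D"
    using V(3) span_minimal[OF D(3) subspace_span] finite_subset by auto
  have "\<exists>f :: 'a \<Rightarrow> real. linear f \<and> (\<forall>x\<in>D. f x = (if x = d then 1 else 0))" for d
    using linear_independent_extend[OF D(2), of "\<lambda>x. if x = d then 1 else 0"] by blast
  then obtain f :: "'a \<Rightarrow> 'a \<Rightarrow> real" where f: "\<And>d. linear (f d)"
    "\<And>d x. x \<in> D \<Longrightarrow> f d x = (if x = d then 1 else 0)" by metis
  have expand: "v = (\<Sum>d\<in>D. f d v *\<^sub>R d)" if v: "v \<in> span D" for v
  proof -
    obtain c where c: "v = (\<Sum>d\<in>D. c d *\<^sub>R d)" using v unfolding span_finite[OF fin] by blast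
    have "f d v = c d" if "d \<in> D" for d
      unfolding c using that fin by (simp add: linear_sum[OF f(1)] linear_cmul[OF f(1)] f(2) if_distrib cong: if_cong)
    with c show ?thesis by simp
  qed
  have "(\<Sum>v\<in>V. v \<otimes> w v) = (\<Sum>d\<in>D. d \<otimes> (\<Sum>v\<in>V. f d v *\<^sub>R w v))" for w :: "'a \<Rightarrow> 'b"
  proof -
    have lin: "linear (\<lambda>a :: 'a. a \<otimes> b)" "linear ((\<otimes>) a :: 'b \<Rightarrow> ('a, 'b) tensor)" for a :: 'a and b :: 'b
      using bilinear_tensor[where 'a = 'a and 'b = 'b] by (simp_all add: bilinear_def)
    have "(\<Sum>v\<in>V. v \<otimes> w v) = (\<Sum>v\<in>V. (\<Sum>d\<in>D. f d v *\<^sub>R d) \<otimes> w v)"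
      using V(2) span expand by (intro sum.cong refl arg_cong[of _ _ "\<lambda>a. a \<otimes> w _"]) auto
    also have "\<dots> = (\<Sum>v\<in>V. \<Sum>d\<in>D. f d v *\<^sub>R (d \<otimes> w v))"
      by (simp add: linear_sum[OF lin(1)] linear_cmul[OF lin(1)])
    also have "\<dots> = (\<Sum>d\<in>D. d \<otimes> (\<Sum>v\<in>V. f d v *\<^sub>R w v))"
      by (subst sum.swap) (simp add: linear_sum[OF lin(2)] linear_cmul[OF lin(2)])
    finally show ?thesis .
  qed
  then show ?thesis using eq[OF f(1)] by simp
qed

text \<open>Contraction by \<open>f\<close> is a well-defined linear map on tensors, by the
  universal property; this gives the converse of the previous criterion.\<close>

lemma tensor_contraction_eq:
  fixes y y' :: "'a::real_vector \<Rightarrow> 'b::real_vector"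
  assumes eq: "(\<Sum>v\<in>V. v \<otimes> y v) = (\<Sum>v\<in>V. v \<otimes> y' v)" and f: "linear (f :: 'a \<Rightarrow> real)"
  shows "(\<Sum>v\<in>V. f v *\<^sub>R y v) = (\<Sum>v\<in>V. f v *\<^sub>R y' v)"
proof -
  have "bilinear (\<lambda>a (b :: 'b). f a *\<^sub>R b)"
    unfolding bilinear_def
    by (auto intro!: linearI simp: linear_add[OF f] linear_cmul[OF f] algebra_simps)
  then obtain L :: "('a, 'b) tensor \<Rightarrow> 'b" where L: "linear L" "\<And>a b. L (a \<otimes> b) = f a *\<^sub>R b"
    using tensor_universal by blast
  show ?thesis using arg_cong[OF eq, of L] by (simp add: linear_sum[OF L(1)] L(2))
qed

section \<open>Limits of families of functionals\<close>

lemma blinfun_almost_norming: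
  fixes f :: "'a::real_normed_vector \<Rightarrow>\<^sub>L real"
  assumes "0 < e"
  obtains a where "norm a \<le> 1" "norm f - e \<le> blinfun_apply f a"
proof (cases "norm f \<le> e")
  case True
  then show ?thesis using that[of 0] by simp
next
  case False
  \<comment> \<open>Otherwise the nonnegative constant \<open>norm f - e\<close> would bound the
    operator norm of \<open>f\<close>.\<close>
  have "\<not> (\<forall>a. norm (blinfun_apply f a) \<le> (norm f - e) * norm a)"
    using norm_blinfun_bound[of "norm f - e" f] False assms by auto
  then obtain a where a: "(norm f - e) * norm a < \<bar>blinfun_apply f a\<bar>" by (auto simp: not_le)
  then have "a \<noteq> 0" by auto
  show ?thesis
  proof (rule that[of "(sgn (blinfun_apply f a) / norm a) *\<^sub>R a"])
    show "norm ((sgn (blinfun_apply f a) / norm a) *\<^sub>R a) \<le> 1" by (simp add: abs_sgn_eq)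
    show "norm f - e \<le> blinfun_apply f ((sgn (blinfun_apply f a) / norm a) *\<^sub>R a)"
      using a \<open>a \<noteq> 0\<close> by (simp add: blinfun.scaleR_right field_simps abs_sgn)
  qed
qed

text \<open>The Banach limit of a bounded sequence of functionals, taken pointwise, replaces a
  weak* cluster point: it preserves linear relations and does not increase norms.\<close>

lemma blinfun_family_banach_limit:
  fixes g :: "nat \<Rightarrow> 'i \<Rightarrow> ('a::real_normed_vector \<Rightarrow>\<^sub>L real)"
  assumes V: "finite V" and le: "\<And>n. (\<Sum>v\<in>V. norm (g n v)) \<le> N n" and N: "N \<longlonglongrightarrow> K"
  obtains h where "(\<Sum>v\<in>V. norm (h v)) \<le> K"
    "\<And>c w. (\<And>n. (\<Sum>v\<in>V. c v *\<^sub>R g n v) = w) \<Longrightarrow> (\<Sum>v\<in>V. c v *\<^sub>R h v) = w"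
proof -
  obtain L :: "(nat \<Rightarrow> real) \<Rightarrow> real" where
    L_add: "\<And>x y. Bseq x \<Longrightarrow> Bseq y \<Longrightarrow> L (\<lambda>n. x n + y n) = L x + L y" and
    L_scale: "\<And>c x. Bseq x \<Longrightarrow> L (\<lambda>n. c * x n) = c * L x" and
    L_le: "\<And>x c. Bseq x \<Longrightarrow> eventually (\<lambda>n. x n \<le> c) sequentially \<Longrightarrow> L x \<le> c"
    by (rule banach_limit_exists) blast
  have L_zero: "L (\<lambda>n. 0) = 0" using L_scale[of "\<lambda>n. 0" 0] by simp
  have L_const: "L (\<lambda>n. c) = c" for c
    using L_le[of "\<lambda>n. c" c] L_le[of "\<lambda>n. - c" "- c"] L_scale[of "\<lambda>n. c" "-1"] by simp
  have B_sum: "Bseq (\<lambda>n. \<Sum>v\<in>S. x v n)" if "finite S" "\<And>v. v \<in> S \<Longrightarrow> Bseq (x v)"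
    for S and x :: "'i \<Rightarrow> nat \<Rightarrow> real"
    using that by (induction S rule: finite_induct) (auto intro: Bseq_plus)
  have L_sum: "L (\<lambda>n. \<Sum>v\<in>S. x v n) = (\<Sum>v\<in>S. L (x v))"
    if "finite S" "\<And>v. v \<in> S \<Longrightarrow> Bseq (x v)" for S and x :: "'i \<Rightarrow> nat \<Rightarrow> real"
    using that by (induction S rule: finite_induct) (auto simp: L_zero L_add B_sum)
  have "Bseq N" using N by (intro convergent_imp_Bseq convergentI)
  then obtain C where C: "\<And>n. N n \<le> C" by (auto simp: Bseq_def abs_le_iff)
  have g_le: "norm (g n v) \<le> C" if "v \<in> V" for n v
    using member_le_sum[of v V "\<lambda>v. norm (g n v)"] that V le[of n] C[of n] by fastforce
  have app_le: "\<bar>blinfun_apply (g n v) a\<bar> \<le> norm a * C" if "v \<in> V" for n v a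
    using norm_blinfun[of "g n v" a] mult_right_mono[OF g_le[OF that, of n], of "norm a"]
    by (simp add: mult.commute)
  have B_app: "Bseq (\<lambda>n. blinfun_apply (g n v) a)" if "v \<in> V" for v a
    using app_le[OF that] by (intro BseqI'[of _ "norm a * C"]) simp
  define H where "H v a = L (\<lambda>n. blinfun_apply (g n v) a)" for v a
  have "bounded_linear (H v)" if v: "v \<in> V" for v
  proof (rule bounded_linear_intro)
    show "H v (a + b) = H v a + H v b" for a b
      by (simp add: H_def blinfun.add_right L_add B_app v)
    show "H v (r *\<^sub>R a) = r *\<^sub>R H v a" for r a
      by (simp add: H_def blinfun.scaleR_right L_scale B_app v)
    show "norm (H v a) \<le> norm a * C" for a
    proof -
      \<comment> \<open>\<open>L\<close> provides upper bounds only; the bound on the absolute value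
        follows by using both \<open>a\<close> and \<open>- a\<close>.\<close>
      have "H v a \<le> norm a * C" for a
        unfolding H_def using app_le[OF v] by (intro L_le B_app v) (auto simp: abs_le_iff)
      moreover have "H v (- a) = - H v a"
        using L_scale[OF B_app[OF v, of a], of "-1"] by (simp add: H_def blinfun.minus_right)
      ultimately show ?thesis by (metis abs_le_iff norm_minus_cancel real_norm_def)
    qed
  qed
  then have app: "blinfun_apply (Blinfun (H v)) a = L (\<lambda>n. blinfun_apply (g n v) a)" if "v \<in> V" for v a
    using that by (simp add: bounded_linear_Blinfun_apply H_def)
  show ?thesis
  proof (rule that[of "\<lambda>v. Blinfun (H v)"])
    show "(\<Sum>v\<in>V. norm (Blinfun (H v))) \<le> K"
    proof (rule field_le_epsilon)
      fix e :: real assume e: "0 < e"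
      \<comment> \<open>The total loss over \<open>V\<close> stays within \<open>e / 2\<close>; the
        added 1 keeps \<open>d\<close> positive when \<open>V\<close> is empty.\<close>
      define d where "d = e / (2 * (real (card V) + 1))"
      have d: "0 < d" using e by (simp add: d_def)
      obtain a where a: "\<And>v. norm (a v) \<le> 1"
        "\<And>v. norm (Blinfun (H v)) - d \<le> blinfun_apply (Blinfun (H v)) (a v)"
        proof -
        have "\<exists>b. norm b \<le> 1 \<and> norm (Blinfun (H v)) - d \<le> blinfun_apply (Blinfun (H v)) b" for v
          using blinfun_almost_norming[OF d] by blast
        then show ?thesis using that by metis
      qed
      have upper: "blinfun_apply (g n v) (a v) \<le> norm (g n v)" for n v
        using norm_blinfun[of "g n v" "a v"] mult_left_mono[OF a(1), of "norm (g n v)" v] by simp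
      \<comment> \<open>Testing each limit functional on its own nearly norming vector turns the sum
        of norms into one value of \<open>L\<close>, so the bound \<open>N n\<close> on the whole
        sum can be used rather than separate bounds for each \<open>v\<close>.\<close>
      have "(\<Sum>v\<in>V. norm (Blinfun (H v)) - d) \<le> (\<Sum>v\<in>V. L (\<lambda>n. blinfun_apply (g n v) (a v)))"
        using a(2) app by (intro sum_mono) metis
      also have "\<dots> = L (\<lambda>n. \<Sum>v\<in>V. blinfun_apply (g n v) (a v))"
        by (simp add: L_sum V B_app)
      also have "\<dots> \<le> K + e / 2"
      proof (rule L_le)
        have "eventually (\<lambda>n. N n < K + e / 2) sequentially"
          using e by (intro order_tendstoD(2)[OF N]) simp
        then show "\<forall>\<^sub>F n in sequentially. (\<Sum>v\<in>V. blinfun_apply (g n v) (a v)) \<le> K + e / 2"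
        proof eventually_elim
          case (elim n)
          have "(\<Sum>v\<in>V. blinfun_apply (g n v) (a v)) \<le> (\<Sum>v\<in>V. norm (g n v))"
            by (intro sum_mono upper)
          then show ?case using le[of n] elim by linarith
        qed
      qed (intro B_sum V B_app)
      finally have "(\<Sum>v\<in>V. norm (Blinfun (H v))) \<le> K + e / 2 + real (card V) * d"
        by (simp add: sum_subtractf)
      moreover have "real (card V) * d \<le> e / 2" using e by (simp add: d_def field_simps)
      ultimately show "(\<Sum>v\<in>V. norm (Blinfun (H v))) \<le> K + e" by linarith
    qed
    fix c w assume w: "\<And>n. (\<Sum>v\<in>V. c v *\<^sub>R g n v) = w"
    show "(\<Sum>v\<in>V. c v *\<^sub>R Blinfun (H v)) = w"
    proof (rule blinfun_eqI)
      fix a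
      \<comment> \<open>Evaluated at \<open>a\<close>, the relation is a constant sequence, which
        \<open>L\<close> maps to its value.\<close>
      have w_app: "(\<Sum>v\<in>V. c v * blinfun_apply (g n v) a) = blinfun_apply w a" for n
        unfolding w[of n, symmetric] by (simp add: blinfun.sum_left blinfun.scaleR_left)
      have "blinfun_apply (\<Sum>v\<in>V. c v *\<^sub>R Blinfun (H v)) a
          = (\<Sum>v\<in>V. L (\<lambda>n. c v * blinfun_apply (g n v) a))"
        by (simp add: blinfun.sum_left blinfun.scaleR_left app L_scale B_app)
      also have "\<dots> = L (\<lambda>n. \<Sum>v\<in>V. c v * blinfun_apply (g n v) a)"
        by (intro L_sum[symmetric] V Bseq_mult Bfun_const B_app)
      finally show "blinfun_apply (\<Sum>v\<in>V. c v *\<^sub>R Blinfun (H v)) a = blinfun_apply w a"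
        by (simp add: w_app L_const)
    qed
  qed
qed

section \<open>Norm attainment over a complemented subspace with polytopal ball\<close>

text \<open>Representations of \<open>u\<close> over the fixed set \<open>V\<close> with costs
  tending to \<open>norm u\<close> are sent to the dual by \<open>J\<close>; the limit family,
  pulled back to the right factor space, still represents \<open>u\<close> and costs at most
  \<open>norm u\<close>.\<close>

lemma tensor_over_polytope_subspace_attains:
  fixes J :: "'b::real_normed_vector \<Rightarrow> ('c::real_normed_vector \<Rightarrow>\<^sub>L real)"
    and ps :: "('a::real_normed_vector \<times> 'b) list"
  assumes M: "finite_dim_subspace M" "one_complemented M" "polytope (cball 0 1 \<inter> M)"
    and J: "isometric_isomorphism J" and ps: "fst ` set ps \<subseteq> M"
  shows "attains_projective_norm (embed_completion (\<Sum>(a, b)\<leftarrow>ps. a \<otimes> b))"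
proof -
  define u where "u = (\<Sum>(a, b)\<leftarrow>ps. a \<otimes> b)"
  obtain V where V: "finite V" "cball 0 1 \<inter> M = convex hull V"
    using M(3) unfolding polytope_def by blast
  obtain B where B: "finite B" "span B = M" using M(1) unfolding finite_dim_subspace_def by blast
  have J_lin: "linear J" and J_bij: "bij J" and J_norm: "\<And>b. norm (J b) = norm b"
    using J by (auto simp: isometric_isomorphism_def)
  have "\<exists>y. u = (\<Sum>v\<in>V. v \<otimes> y v) \<and> (\<Sum>v\<in>V. norm (y v)) < norm u + inverse (real (Suc n))" for n
    using tensor_near_optimal_over_ball_generators[OF V M(2) u_def ps] by (metis inverse_positive_iff_positive of_nat_0_less_iff zero_less_Suc)
  then obtain y where y: "\<And>n. u = (\<Sum>v\<in>V. v \<otimes> y n v)"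
    "\<And>n. (\<Sum>v\<in>V. norm (y n v)) < norm u + inverse (real (Suc n))" by metis
  obtain h where h: "(\<Sum>v\<in>V. norm (h v)) \<le> norm u"
    "\<And>c w. (\<And>n. (\<Sum>v\<in>V. c v *\<^sub>R J (y n v)) = w) \<Longrightarrow> (\<Sum>v\<in>V. c v *\<^sub>R h v) = w"
  proof (rule blinfun_family_banach_limit[OF V(1)])
    show "(\<Sum>v\<in>V. norm (J (y n v))) \<le> norm u + inverse (real (Suc n))" for n
      using y(2)[of n] by (simp add: J_norm)
    show "(\<lambda>n. norm u + inverse (real (Suc n))) \<longlonglongrightarrow> norm u"
      using tendsto_add[OF tendsto_const LIMSEQ_inverse_real_of_nat, of "norm u"] by simp
  qed blast
  define w where "w v = inv J (h v)" for v
  have Jw: "J (w v) = h v" for v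
    unfolding w_def using J_bij by (simp add: bij_is_surj surj_f_inv_f)
  have uw: "u = (\<Sum>v\<in>V. v \<otimes> w v)"
    unfolding y(1)[of 0]
  proof (rule tensor_eqI_of_contractions[OF V(1) _ B(1)])
    show "V \<subseteq> span B" using V(2) B(2) hull_subset[of V convex] by blast
    fix f :: "'a \<Rightarrow> real" assume f: "linear f"
    have J_sum: "J (\<Sum>v\<in>V. f v *\<^sub>R x v) = (\<Sum>v\<in>V. f v *\<^sub>R J (x v))" for x
      by (simp add: linear_sum[OF J_lin] linear_cmul[OF J_lin])
    \<comment> \<open>Every \<open>y n\<close> represents \<open>u\<close>, so its contraction by
      \<open>f\<close> does not depend on \<open>n\<close>, and the limit family \<open>h\<close>
      inherits the common value.\<close>
    have "(\<Sum>v\<in>V. f v *\<^sub>R y n v) = (\<Sum>v\<in>V. f v *\<^sub>R y 0 v)" for n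
      using y(1) by (intro tensor_contraction_eq[OF _ f]) metis
    then have "(\<Sum>v\<in>V. f v *\<^sub>R h v) = J (\<Sum>v\<in>V. f v *\<^sub>R y 0 v)"
      by (intro h(2)) (metis J_sum)
    then have "J (\<Sum>v\<in>V. f v *\<^sub>R y 0 v) = J (\<Sum>v\<in>V. f v *\<^sub>R w v)" by (simp add: J_sum Jw)
    then show "(\<Sum>v\<in>V. f v *\<^sub>R y 0 v) = (\<Sum>v\<in>V. f v *\<^sub>R w v)"
      using J_bij by (simp add: bij_is_inj inj_eq)
  qed
  \<comment> \<open>Generators lie in the unit ball, so inserting the factor \<open>norm v\<close>
    does not increase the cost.\<close>
  have "norm v \<le> 1" if "v \<in> V" for v using V(2) hull_subset[of V convex] that by auto
  then have "(\<Sum>v\<in>V. norm v * norm (w v)) \<le> (\<Sum>v\<in>V. norm (w v))"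
    by (intro sum_mono mult_left_le_one_le) auto
  also have "\<dots> \<le> norm u" using h(1) by (simp add: J_norm flip: Jw)
  finally show ?thesis
    using attains_projective_norm_finite_sum[OF V(1), of w] by (simp add: u_def[symmetric] flip: uw)
qed

section \<open>Density of the norm-attaining tensors\<close>

lemma attains_projective_norm_zero: "attains_projective_norm (embed_completion 0)"
  using attains_projective_norm_finite_sum[of "{}"] by simp

text \<open>The pairs \<open>(a - r a, b)\<close> represent the difference. Linearity of
  \<open>r\<close> is not at issue, since it is applied term by term to one fixed
  representation.\<close>

lemma tensor_perturb_left:
  fixes ps :: "('a::real_normed_vector \<times> 'b::real_normed_vector) list"
  assumes "\<And>a b. (a, b) \<in> set ps \<Longrightarrow> norm (a - r a) \<le> d * norm a"
  shows "norm ((\<Sum>(a, b)\<leftarrow>ps. a \<otimes> b) - (\<Sum>(a, b)\<leftarrow>ps. r a \<otimes> b)) \<le> d * (\<Sum>(a, b)\<leftarrow>ps. norm a * norm b)"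
proof -
  have "(\<Sum>(a, b)\<leftarrow>ps. a \<otimes> b) - (\<Sum>(a, b)\<leftarrow>ps. r a \<otimes> b) = (\<Sum>(a, b)\<leftarrow>map (\<lambda>(a, b). (a - r a, b)) ps. a \<otimes> b)"
    by (induction ps) (auto simp: bilinear_lsub[OF bilinear_tensor])
  also have "norm \<dots> \<le> (\<Sum>(a, b)\<leftarrow>map (\<lambda>(a, b). (a - r a, b)) ps. norm a * norm b)"
    by (rule norm_tensor_le)
  also have "\<dots> \<le> d * (\<Sum>(a, b)\<leftarrow>ps. norm a * norm b)"
    using assms
  proof (induction ps)
    case (Cons p ps)
    obtain a b where p: "p = (a, b)" by force
    have "norm (a - r a) * norm b \<le> d * norm a * norm b"
      using Cons.prems[of a b] p by (intro mult_right_mono) auto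
    moreover have "(\<Sum>(a, b)\<leftarrow>map (\<lambda>(a, b). (a - r a, b)) ps. norm a * norm b) \<le> d * (\<Sum>(a, b)\<leftarrow>ps. norm a * norm b)"
      using Cons.prems by (intro Cons.IH) auto
    ultimately show ?case by (simp add: p algebra_simps)
  qed simp
  finally show ?thesis .
qed

theorem theorem4p2:
  fixes J :: "'y::banach \<Rightarrow> ('z::banach \<Rightarrow>\<^sub>L real)"
  assumes "polyhedral_space TYPE('x::banach)"
    and "metric_pi_property TYPE('x)"
    and "isometric_isomorphism J"
  shows "closure (NA_proj :: ('x, 'y) proj_tensor set) = UNIV"
proof -
  have near: "\<exists>t. attains_projective_norm (embed_completion t) \<and> norm (u - t) < e"
    if e: "0 < e" for u :: "('x, 'y) tensor" and e
  proof -
    obtain ps where u: "u = (\<Sum>(a, b)\<leftarrow>ps. a \<otimes> b)" by (rule tensor_representation)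
    let ?s = "\<Sum>(a, b)\<leftarrow>ps. norm a * norm b"
    \<comment> \<open>The metric \<pi>-property speaks of unit vectors, so zero left factors are
      dropped and the others normalised.\<close>
    define F where "F = (\<lambda>a. a /\<^sub>R norm a) ` (fst ` set ps - {0})"
    show ?thesis
    \<comment> \<open>The \<pi>-property requires a nonempty set; if \<open>F\<close> is empty, all
      left factors vanish and so does \<open>u\<close>.\<close>
    proof (cases "F = {}")
      case True
      then have "a = 0" if "(a, b) \<in> set ps" for a b using that by (force simp: F_def)
      then have "\<forall>p\<in>set ps. fst p = 0" by auto
      then have "\<forall>p\<in>set ps. (case p of (a, b) \<Rightarrow> a \<otimes> b) = 0"
        by (auto simp: bilinear_lzero[OF bilinear_tensor] split: prod.splits)
      then have "u = 0" by (simp add: u sum_list_nonneg_eq_0_iff cong: map_cong)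
      then show ?thesis using attains_projective_norm_zero e by (intro exI[of _ 0]) simp
    next
      case False
      have s: "0 \<le> ?s" by (rule sum_norms_nonneg)
      \<comment> \<open>This makes \<open>d * ?s < e\<close>, and the added 1 avoids division by
        zero when \<open>?s = 0\<close>.\<close>
      define d where "d = e / (?s + 1)"
      have d: "0 < d" using e s by (simp add: d_def)
      have "finite F" by (simp add: F_def)
      moreover have "F \<subseteq> sphere 0 1"
        unfolding F_def by (intro subsetI, elim imageE) (simp add: field_simps)
      moreover note False d assms(2)
      ultimately obtain M where M: "finite_dim_subspace M" "one_complemented M"
        "\<forall>x\<in>F. \<exists>x'\<in>M. norm (x - x') < d"
        unfolding metric_pi_property_def by metis
      then obtain g where g: "\<And>x. x \<in> F \<Longrightarrow> g x \<in> M" "\<And>x. x \<in> F \<Longrightarrow> norm (x - g x) < d" by metis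
      have sub: "subspace M" using M(1) unfolding finite_dim_subspace_def by auto
      \<comment> \<open>Rescaling the approximant of the normalised vector gives an error relative
        to \<open>norm a\<close>; zero is kept fixed because it has no counterpart in
        \<open>F\<close>.\<close>
      define r where "r a = (if a = 0 then 0 else norm a *\<^sub>R g (a /\<^sub>R norm a))" for a
      have r: "r a \<in> M \<and> norm (a - r a) \<le> d * norm a" if ab: "(a, b) \<in> set ps" for a b
      proof (cases "a = 0")
        case False
        then have F: "a /\<^sub>R norm a \<in> F" using ab by (force simp: F_def)
        have "a - r a = norm a *\<^sub>R (a /\<^sub>R norm a - g (a /\<^sub>R norm a))"
          using False by (simp add: r_def scaleR_diff_right)
        then have "norm (a - r a) = norm a * norm (a /\<^sub>R norm a - g (a /\<^sub>R norm a))" by simp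
        also have "\<dots> \<le> norm a * d" using g(2)[OF F] by (intro mult_left_mono) auto
        finally show ?thesis
          using False g(1)[OF F] sub by (simp add: r_def subspace_scale mult.commute)
      qed (use sub in \<open>auto simp: r_def subspace_0\<close>)
      let ?qs = "map (\<lambda>(a, b). (r a, b)) ps"
      have "polytope (cball 0 1 \<inter> M)" using assms(1) M(1) by (simp add: polyhedral_space_def)
      then have "attains_projective_norm (embed_completion (\<Sum>(a, b)\<leftarrow>?qs. a \<otimes> b))"
        using r by (intro tensor_over_polytope_subspace_attains[OF M(1,2) _ assms(3)]) auto
      moreover have "(\<Sum>(a, b)\<leftarrow>?qs. a \<otimes> b) = (\<Sum>(a, b)\<leftarrow>ps. r a \<otimes> b)"
        by (simp add: o_def case_prod_unfold)
      moreover have "norm (u - (\<Sum>(a, b)\<leftarrow>ps. r a \<otimes> b)) \<le> d * ?s"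
        unfolding u using r by (intro tensor_perturb_left) blast
      moreover have "d * ?s < e" using e s by (simp add: d_def field_simps)
      ultimately show ?thesis
        by (intro exI[of _ "\<Sum>(a, b)\<leftarrow>ps. r a \<otimes> b"] conjI) (simp, linarith)
    qed
  qed
  \<comment> \<open>Algebraic tensors are dense in the completion, so half of \<open>e\<close> goes
    to reaching one of them and half to \<open>near\<close>.\<close>
  have "z \<in> closure NA_proj" for z :: "('x, 'y) proj_tensor"
    unfolding closure_approachable
  proof (intro allI impI)
    fix e :: real assume e: "0 < e"
    have "z \<in> closure (range embed_completion)" by (simp add: closure_range_embed_completion)
    then obtain u where u: "dist (embed_completion u) z < e / 2"
      using e unfolding closure_approachable by (metis half_gt_zero imageE)
    obtain t where t: "attains_projective_norm (embed_completion t)" "norm (u - t) < e / 2"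
      using near[of "e / 2" u] e by auto
    have "dist (embed_completion t) (embed_completion u) < e / 2"
      using t(2) unfolding dist_embed_completion by (simp add: dist_norm norm_minus_commute)
    with u have "dist (embed_completion t) z < e"
      using dist_triangle[of "embed_completion t" z "embed_completion u"] by linarith
    with t(1) show "\<exists>w\<in>NA_proj. dist w z < e" by (auto simp: NA_proj_def)
  qed
  then show ?thesis by auto
qed

end
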